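(* Let $M$ be a helix surface in $\mathbb{H}^3_{1,\tau}$ with unit normal $N$, $\lambda=g_\tau(N,N)$, and constant angle function $\nu\neq0$. Then the following hold: (i) with respect to the tangent basis $\{T,JT\}$ the matrix of the shape operator is $$A=\begin{pmatrix}0&-\frac{\sqrt\kappa}{2}\lambda\tau\\ \frac{\sqrt\kappa}{2}\tau&\mu\end{pmatrix}$$ for some smooth function $\mu$ on $M$ (that is, $A(T)=\frac{\sqrt\kappa}{2}\tau JT$ and $A(JT)=-\frac{\sqrt\kappa}{2}\lambda\tau T+\mu JT$); (ii) the Levi-Civita connection $\nabla$ of $M$ is described by $$\nabla_TT=\nu\tau\sqrt\kappa\,JT,\quad \nabla_{JT}T=\mu\nu\,JT,\quad \nabla_TJT=\lambda\nu\tau\sqrt\kappa\,T,\quad \nabla_{JT}JT=\lambda\mu\nu\,T;$$ (iii) the Gaussian curvature of $M$ is $K=\lambda\kappa\nu^2(1-\tau^2)$; (iv) the function $\mu$ satisfies $$T(\mu)+\nu\mu^2+\kappa\nu B=0,\qquad\text{where } B:=\nu^2(\tau^2-1)-\lambda.$$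
   Context: Let $\kappa>0$ and $\tau>0$ be real constants. $\mathbb{R}^4_2$ is $\mathbb{R}^4$ with the metric $g_0=dx_1^2+dx_2^2-dx_3^2-dx_4^2$. The anti-de Sitter space is $\mathbb{H}^3_1(\kappa/4)=\{x\in\mathbb{R}^4: x_1^2+x_2^2-x_3^2-x_4^2=-4/\kappa\}$, with $\langle\,,\rangle$ the Lorentzian metric induced by $g_0$. Define linear maps of $\mathbb{R}^4$ by $J_1(x)=(-x_2,x_1,-x_4,x_3)$, $J_2(x)=(x_3,-x_4,x_1,-x_2)$, $J_3(x)=(x_4,x_3,x_2,x_1)$, and $X_i(q)=\frac{\sqrt\kappa}{2}J_iq$; $X_1$ is the hyperbolic Hopf vector field. The Berger-like metric is $g_\tau(X,Y)=\langle X,Y\rangle+(1-\tau^2)\langle X,X_1\rangle\langle Y,X_1\rangle$; $E_1=\tau^{-1}X_1$, $E_2=X_2$, $E_3=X_3$ is a $g_\tau$-pseudo-orthonormal frame with $E_1$ timelike; $\mathbb{H}^3_{1,\tau}=(\mathbb{H}^3_1(\kappa/4),g_\tau)$, with Levi-Civita connection $\nabla^\tau$. The wedge product is the bilinear skew product with $E_1\wedge E_2=E_3$, $E_2\wedge E_3=-E_1$, $E_3\wedge E_1=E_2$. For an oriented pseudo-Riemannian surface $M$ immersed in $\mathbb{H}^3_{1,\tau}$ with unit normal $N$, put $\lambda=g_\tau(N,N)\in\{-1,1\}$ ($M$ is spacelike if $\lambda=-1$, timelike if $\lambda=1$), angle function $\nu=\lambda g_\tau(N,E_1)$, and $E_1=T+\nu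 N$ with $T$ tangent to $M$; $JX=N\wedge X$ for $X$ tangent to $M$; $A(X)=-\nabla^\tau_XN$. $M$ is a helix surface if $\nu$ is constant. Throughout it is assumed that $\nu\ne0$. *)

theory Defs
  imports "HOL-Analysis.Analysis"
begin

section \<open>Smooth maps between Euclidean spaces\<close>

text \<open>On an open set \<open>S\<close> of a finite-dimensional space, \<open>Ck_on n f S\<close> is the usual class of
  \<open>n\<close> times continuously differentiable maps: all iterated directional derivatives up to order
  \<open>n\<close> exist and the last ones are continuous.\<close>

primrec Ck_on :: "nat \<Rightarrow> ('a::real_normed_vector \<Rightarrow> 'b::real_normed_vector) \<Rightarrow> 'a set \<Rightarrow> bool" where
  "Ck_on 0 f S \<longleftrightarrow> continuous_on S f"
| "Ck_on (Suc n) f S \<longleftrightarrow>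
     (\<forall>x\<in>S. f differentiable (at x)) \<and> (\<forall>v. Ck_on n (\<lambda>x. frechet_derivative f (at x) v) S)"

definition Cinf_on :: "('a::real_normed_vector \<Rightarrow> 'b::real_normed_vector) \<Rightarrow> 'a set \<Rightarrow> bool" where
  "Cinf_on f S \<longleftrightarrow> (\<forall>n. Ck_on n f S)"

section \<open>Levi-Civita connections and curvature\<close>

text \<open>The data of a pseudo-Riemannian manifold used below: its points, the smooth real functions,
  the smooth vector fields, the derivative \<open>dif f p v\<close> of a function in the direction of a tangent
  vector \<open>v\<close> at \<open>p\<close>, and the metric.  Only values at points of \<open>pts\<close> and on tangent vectors are
  meaningful.\<close>

record ('p, 'v) geometry =
  pts  :: "'p set"
  fns  :: "('p \<Rightarrow> real) set"
  flds :: "('p \<Rightarrow> 'v) set"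
  dif  :: "('p \<Rightarrow> real) \<Rightarrow> 'p \<Rightarrow> 'v \<Rightarrow> real"
  met  :: "'p \<Rightarrow> 'v \<Rightarrow> 'v \<Rightarrow> real"

definition is_lie_bracket ::
    "('p, 'v) geometry \<Rightarrow> ('p \<Rightarrow> 'v) \<Rightarrow> ('p \<Rightarrow> 'v) \<Rightarrow> ('p \<Rightarrow> 'v) \<Rightarrow> bool" where
  "is_lie_bracket G X Y W \<longleftrightarrow> W \<in> flds G \<and>
     (\<forall>f\<in>fns G. \<forall>p\<in>pts G.
        dif G f p (W p) =
          dif G (\<lambda>q. dif G f q (Y q)) p (X p) - dif G (\<lambda>q. dif G f q (X q)) p (Y p))"

definition affine_connection ::
    "('p, 'v::real_vector) geometry \<Rightarrow> (('p \<Rightarrow> 'v) \<Rightarrow> ('p \<Rightarrow> 'v) \<Rightarrow> 'p \<Rightarrow> 'v) \<Rightarrow> bool" where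
  "affine_connection G D \<longleftrightarrow>
     (\<forall>X\<in>flds G. \<forall>Y\<in>flds G. D X Y \<in> flds G) \<and>
     (\<forall>X\<in>flds G. \<forall>X'\<in>flds G. \<forall>Y\<in>flds G. \<forall>p\<in>pts G.
        D (\<lambda>q. X q + X' q) Y p = D X Y p + D X' Y p) \<and>
     (\<forall>f\<in>fns G. \<forall>X\<in>flds G. \<forall>Y\<in>flds G. \<forall>p\<in>pts G.
        D (\<lambda>q. f q *\<^sub>R X q) Y p = f p *\<^sub>R D X Y p) \<and>
     (\<forall>X\<in>flds G. \<forall>Y\<in>flds G. \<forall>Y'\<in>flds G. \<forall>p\<in>pts G.
        D X (\<lambda>q. Y q + Y' q) p = D X Y p + D X Y' p) \<and>
     (\<forall>f\<in>fns G. \<forall>X\<in>flds G. \<forall>Y\<in>flds G. \<forall>p\<in>pts G.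
        D X (\<lambda>q. f q *\<^sub>R Y q) p = dif G f p (X p) *\<^sub>R Y p + f p *\<^sub>R D X Y p)"

definition levi_civita ::
    "('p, 'v::real_vector) geometry \<Rightarrow> (('p \<Rightarrow> 'v) \<Rightarrow> ('p \<Rightarrow> 'v) \<Rightarrow> 'p \<Rightarrow> 'v) \<Rightarrow> bool" where
  "levi_civita G D \<longleftrightarrow> affine_connection G D \<and>
     (\<forall>X\<in>flds G. \<forall>Y\<in>flds G. is_lie_bracket G X Y (\<lambda>p. D X Y p - D Y X p)) \<and>
     (\<forall>X\<in>flds G. \<forall>Y\<in>flds G. \<forall>Z\<in>flds G. \<forall>p\<in>pts G.
        dif G (\<lambda>q. met G q (Y q) (Z q)) p (X p) =
          met G p (D X Y p) (Z p) + met G p (Y p) (D X Z p))"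

text \<open>\<open>K\<close> is the Gaussian (sectional) curvature of a surface with connection \<open>D\<close>, where
  \<open>R(X,Y)Z = D_X D_Y Z - D_Y D_X Z - D_[X,Y] Z\<close>.\<close>

definition has_gaussian_curvature ::
    "('p, 'v::real_vector) geometry \<Rightarrow> (('p \<Rightarrow> 'v) \<Rightarrow> ('p \<Rightarrow> 'v) \<Rightarrow> 'p \<Rightarrow> 'v) \<Rightarrow> ('p \<Rightarrow> real) \<Rightarrow> bool"
  where
  "has_gaussian_curvature G D K \<longleftrightarrow>
     (\<forall>X\<in>flds G. \<forall>Y\<in>flds G. \<forall>W. is_lie_bracket G X Y W \<longrightarrow> (\<forall>p\<in>pts G.
        let Q = met G p (X p) (X p) * met G p (Y p) (Y p) - (met G p (X p) (Y p))\<^sup>2;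
            RXYY = D X (D Y Y) p - D Y (D X Y) p - D W Y p
        in Q \<noteq> 0 \<longrightarrow> K p = met G p RXYY (X p) / Q))"

section \<open>The Lorentzian Berger-like space\<close>

definition g0 :: "real^4 \<Rightarrow> real^4 \<Rightarrow> real" where
  "g0 u v = u$1 * v$1 + u$2 * v$2 - u$3 * v$3 - u$4 * v$4"

definition AdS :: "real \<Rightarrow> (real^4) set" where
  "AdS \<kappa> = {x. g0 x x = - 4 / \<kappa>}"

definition AdS_tangent :: "real^4 \<Rightarrow> (real^4) set" where
  "AdS_tangent q = {v. g0 q v = 0}"

definition J1 :: "real^4 \<Rightarrow> real^4" where "J1 x = vector [- x$2, x$1, - x$4, x$3]"
definition J2 :: "real^4 \<Rightarrow> real^4" where "J2 x = vector [x$3, - x$4, x$1, - x$2]"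
definition J3 :: "real^4 \<Rightarrow> real^4" where "J3 x = vector [x$4, x$3, x$2, x$1]"

definition X1 :: "real \<Rightarrow> real^4 \<Rightarrow> real^4" where "X1 \<kappa> q = (sqrt \<kappa> / 2) *\<^sub>R J1 q"
definition X2 :: "real \<Rightarrow> real^4 \<Rightarrow> real^4" where "X2 \<kappa> q = (sqrt \<kappa> / 2) *\<^sub>R J2 q"
definition X3 :: "real \<Rightarrow> real^4 \<Rightarrow> real^4" where "X3 \<kappa> q = (sqrt \<kappa> / 2) *\<^sub>R J3 q"

definition g_tau :: "real \<Rightarrow> real \<Rightarrow> real^4 \<Rightarrow> real^4 \<Rightarrow> real^4 \<Rightarrow> real" where
  "g_tau \<kappa> \<tau> q u v = g0 u v + (1 - \<tau>\<^sup>2) * g0 u (X1 \<kappa> q) * g0 v (X1 \<kappa> q)"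

definition E1 :: "real \<Rightarrow> real \<Rightarrow> real^4 \<Rightarrow> real^4" where "E1 \<kappa> \<tau> q = (1 / \<tau>) *\<^sub>R X1 \<kappa> q"
definition E2 :: "real \<Rightarrow> real^4 \<Rightarrow> real^4" where "E2 \<kappa> q = X2 \<kappa> q"
definition E3 :: "real \<Rightarrow> real^4 \<Rightarrow> real^4" where "E3 \<kappa> q = X3 \<kappa> q"

text \<open>The bilinear skew product with \<open>E1 \<and> E2 = E3\<close>, \<open>E2 \<and> E3 = - E1\<close>, \<open>E3 \<and> E1 = E2\<close>; a tangent
  vector \<open>u\<close> has frame components \<open>- g_tau(u,E1)\<close>, \<open>g_tau(u,E2)\<close>, \<open>g_tau(u,E3)\<close> as \<open>E1\<close> is
  timelike.\<close>

definition wedge_tau :: "real \<Rightarrow> real \<Rightarrow> real^4 \<Rightarrow> real^4 \<Rightarrow> real^4 \<Rightarrow> real^4" where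
  "wedge_tau \<kappa> \<tau> q u v =
     (let u1 = - g_tau \<kappa> \<tau> q u (E1 \<kappa> \<tau> q); u2 = g_tau \<kappa> \<tau> q u (E2 \<kappa> q); u3 = g_tau \<kappa> \<tau> q u (E3 \<kappa> q);
          v1 = - g_tau \<kappa> \<tau> q v (E1 \<kappa> \<tau> q); v2 = g_tau \<kappa> \<tau> q v (E2 \<kappa> q); v3 = g_tau \<kappa> \<tau> q v (E3 \<kappa> q)
      in (u1 * v2 - u2 * v1) *\<^sub>R E3 \<kappa> q - (u2 * v3 - u3 * v2) *\<^sub>R E1 \<kappa> \<tau> q
         + (u3 * v1 - u1 * v3) *\<^sub>R E2 \<kappa> q)"

text \<open>Smoothness on the quadric means local smooth extendability to the ambient space.\<close>

definition AdS_smooth :: "real \<Rightarrow> (real^4 \<Rightarrow> 'b::real_normed_vector) \<Rightarrow> bool" where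
  "AdS_smooth \<kappa> f \<longleftrightarrow>
     (\<forall>q\<in>AdS \<kappa>. \<exists>W h. open W \<and> q \<in> W \<and> Cinf_on h W \<and> (\<forall>x\<in>W \<inter> AdS \<kappa>. h x = f x))"

text \<open>A derivative at \<open>q\<close> within the quadric is not unique as a linear map on \<open>\<real>\<^sup>4\<close>, but its values
  on vectors tangent to the quadric at \<open>q\<close> are, and only these are used.\<close>

definition AdS_geometry :: "real \<Rightarrow> real \<Rightarrow> (real^4, real^4) geometry" where
  "AdS_geometry \<kappa> \<tau> =
     \<lparr> pts = AdS \<kappa>,
       fns = {f. AdS_smooth \<kappa> f},
       flds = {Y. AdS_smooth \<kappa> Y \<and> (\<forall>q\<in>AdS \<kappa>. Y q \<in> AdS_tangent q)},
       dif = (\<lambda>f q v. frechet_derivative f (at q within AdS \<kappa>) v),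
       met = g_tau \<kappa> \<tau> \<rparr>"

section \<open>Immersed surfaces\<close>

type_synonym 'm chart = "'m set \<times> ('m \<Rightarrow> real^2)"

definition smooth_surface :: "'m topology \<Rightarrow> 'm chart set \<Rightarrow> bool" where
  "smooth_surface S Atl \<longleftrightarrow>
     Hausdorff_space S \<and> second_countable S \<and>
     (\<forall>(U, \<phi>)\<in>Atl. openin S U \<and> open (\<phi> ` U) \<and>
        homeomorphic_map (subtopology S U) (top_of_set (\<phi> ` U)) \<phi>) \<and>
     (\<Union>(U, \<phi>)\<in>Atl. U) = topspace S \<and>
     (\<forall>(U, \<phi>)\<in>Atl. \<forall>(V, \<psi>)\<in>Atl. Cinf_on (\<psi> \<circ> inv_into U \<phi>) (\<phi> ` (U \<inter> V)))"

definition surface_smooth :: "'m chart set \<Rightarrow> ('m \<Rightarrow> 'b::real_normed_vector) \<Rightarrow> bool" where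
  "surface_smooth Atl f \<longleftrightarrow> (\<forall>(U, \<phi>)\<in>Atl. Cinf_on (f \<circ> inv_into U \<phi>) (\<phi> ` U))"

definition chart_derivative ::
    "'m chart \<Rightarrow> ('m \<Rightarrow> 'b::real_normed_vector) \<Rightarrow> 'm \<Rightarrow> real^2 \<Rightarrow> 'b" where
  "chart_derivative c f p w =
     frechet_derivative (f \<circ> inv_into (fst c) (snd c)) (at (snd c p)) w"

text \<open>Tangent vectors of an immersed surface are identified with their images under the
  differential of the immersion \<open>F\<close>; thus a vector field on the surface is a map into \<open>\<real>\<^sup>4\<close>.\<close>

definition surface_tangent :: "'m chart set \<Rightarrow> ('m \<Rightarrow> real^4) \<Rightarrow> 'm \<Rightarrow> (real^4) set" where
  "surface_tangent Atl F p = {v. \<exists>c\<in>Atl. p \<in> fst c \<and> v \<in> range (chart_derivative c F p)}"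

definition surface_derivative ::
    "'m chart set \<Rightarrow> ('m \<Rightarrow> real^4) \<Rightarrow> ('m \<Rightarrow> real) \<Rightarrow> 'm \<Rightarrow> real^4 \<Rightarrow> real" where
  "surface_derivative Atl F f p v =
     (THE d. \<exists>c\<in>Atl. \<exists>w. p \<in> fst c \<and> v = chart_derivative c F p w \<and> d = chart_derivative c f p w)"

definition surface_geometry ::
    "real \<Rightarrow> real \<Rightarrow> 'm topology \<Rightarrow> 'm chart set \<Rightarrow> ('m \<Rightarrow> real^4) \<Rightarrow> ('m, real^4) geometry" where
  "surface_geometry \<kappa> \<tau> S Atl F =
     \<lparr> pts = topspace S,
       fns = {f. surface_smooth Atl f},
       flds = {Y. surface_smooth Atl Y \<and> (\<forall>p\<in>topspace S. Y p \<in> surface_tangent Atl F p)},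
       dif = surface_derivative Atl F,
       met = (\<lambda>p. g_tau \<kappa> \<tau> (F p)) \<rparr>"

definition pseudo_riemannian_immersion ::
    "real \<Rightarrow> real \<Rightarrow> 'm topology \<Rightarrow> 'm chart set \<Rightarrow> ('m \<Rightarrow> real^4) \<Rightarrow> bool" where
  "pseudo_riemannian_immersion \<kappa> \<tau> S Atl F \<longleftrightarrow>
     surface_smooth Atl F \<and>
     (\<forall>p\<in>topspace S. F p \<in> AdS \<kappa>) \<and>
     (\<forall>c\<in>Atl. \<forall>p\<in>fst c. inj (chart_derivative c F p)) \<and>
     (\<forall>p\<in>topspace S. \<forall>v\<in>surface_tangent Atl F p.
        (\<forall>w\<in>surface_tangent Atl F p. g_tau \<kappa> \<tau> (F p) v w = 0) \<longrightarrow> v = 0)"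

definition fields_along :: "'m topology \<Rightarrow> 'm chart set \<Rightarrow> ('m \<Rightarrow> real^4) \<Rightarrow> ('m \<Rightarrow> real^4) set" where
  "fields_along S Atl F =
     {V. surface_smooth Atl V \<and> (\<forall>p\<in>topspace S. V p \<in> AdS_tangent (F p))}"

definition unit_normal ::
    "real \<Rightarrow> real \<Rightarrow> 'm topology \<Rightarrow> 'm chart set \<Rightarrow> ('m \<Rightarrow> real^4) \<Rightarrow> real \<Rightarrow> ('m \<Rightarrow> real^4) \<Rightarrow> bool" where
  "unit_normal \<kappa> \<tau> S Atl F lam N \<longleftrightarrow>
     N \<in> fields_along S Atl F \<and> lam \<in> {-1, 1} \<and>
     (\<forall>p\<in>topspace S. g_tau \<kappa> \<tau> (F p) (N p) (N p) = lam \<and>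
        (\<forall>v\<in>surface_tangent Atl F p. g_tau \<kappa> \<tau> (F p) (N p) v = 0))"

text \<open>The connection induced along the immersion by a connection \<open>DH\<close> of the ambient space, i.e.
  the pull-back connection, which gives meaning to \<open>DH_X N\<close> for a field \<open>N\<close> defined only along the
  surface: it is determined by the Leibniz rule and its values on restrictions of ambient fields.\<close>

definition connection_along ::
    "real \<Rightarrow> real \<Rightarrow> 'm topology \<Rightarrow> 'm chart set \<Rightarrow> ('m \<Rightarrow> real^4) \<Rightarrow>
     ((real^4 \<Rightarrow> real^4) \<Rightarrow> (real^4 \<Rightarrow> real^4) \<Rightarrow> real^4 \<Rightarrow> real^4) \<Rightarrow>
     (('m \<Rightarrow> real^4) \<Rightarrow> ('m \<Rightarrow> real^4) \<Rightarrow> 'm \<Rightarrow> real^4) \<Rightarrow> bool" where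
  "connection_along \<kappa> \<tau> S Atl F DH P \<longleftrightarrow>
     (let G = surface_geometry \<kappa> \<tau> S Atl F; H = AdS_geometry \<kappa> \<tau>; \<Gamma> = fields_along S Atl F in
      (\<forall>X\<in>flds G. \<forall>V\<in>\<Gamma>. P X V \<in> \<Gamma>) \<and>
      (\<forall>X\<in>flds G. \<forall>X'\<in>flds G. \<forall>V\<in>\<Gamma>. \<forall>p\<in>pts G.
         P (\<lambda>q. X q + X' q) V p = P X V p + P X' V p) \<and>
      (\<forall>f\<in>fns G. \<forall>X\<in>flds G. \<forall>V\<in>\<Gamma>. \<forall>p\<in>pts G.
         P (\<lambda>q. f q *\<^sub>R X q) V p = f p *\<^sub>R P X V p) \<and>
      (\<forall>X\<in>flds G. \<forall>V\<in>\<Gamma>. \<forall>V'\<in>\<Gamma>. \<forall>p\<in>pts G.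
         P X (\<lambda>q. V q + V' q) p = P X V p + P X V' p) \<and>
      (\<forall>f\<in>fns G. \<forall>X\<in>flds G. \<forall>V\<in>\<Gamma>. \<forall>p\<in>pts G.
         P X (\<lambda>q. f q *\<^sub>R V q) p = dif G f p (X p) *\<^sub>R V p + f p *\<^sub>R P X V p) \<and>
      (\<forall>X\<in>flds G. \<forall>Y\<in>flds H. \<forall>Z\<in>flds H. \<forall>p\<in>pts G.
         Z (F p) = X p \<longrightarrow> P X (\<lambda>q. Y (F q)) p = DH Z Y (F p)))"

definition shape_operator ::
    "(('m \<Rightarrow> real^4) \<Rightarrow> ('m \<Rightarrow> real^4) \<Rightarrow> 'm \<Rightarrow> real^4) \<Rightarrow> ('m \<Rightarrow> real^4) \<Rightarrow> ('m \<Rightarrow> real^4) \<Rightarrow> 'm \<Rightarrow> real^4"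
  where
  "shape_operator P N X p = - P X N p"

definition angle_function ::
    "real \<Rightarrow> real \<Rightarrow> ('m \<Rightarrow> real^4) \<Rightarrow> real \<Rightarrow> ('m \<Rightarrow> real^4) \<Rightarrow> 'm \<Rightarrow> real" where
  "angle_function \<kappa> \<tau> F lam N p = lam * g_tau \<kappa> \<tau> (F p) (N p) (E1 \<kappa> \<tau> (F p))"

definition tangent_part ::
    "real \<Rightarrow> real \<Rightarrow> ('m \<Rightarrow> real^4) \<Rightarrow> real \<Rightarrow> ('m \<Rightarrow> real^4) \<Rightarrow> 'm \<Rightarrow> real^4" where
  "tangent_part \<kappa> \<tau> F lam N p =
     E1 \<kappa> \<tau> (F p) - angle_function \<kappa> \<tau> F lam N p *\<^sub>R N p"

definition J_rot ::
    "real \<Rightarrow> real \<Rightarrow> ('m \<Rightarrow> real^4) \<Rightarrow> ('m \<Rightarrow> real^4) \<Rightarrow> ('m \<Rightarrow> real^4) \<Rightarrow> 'm \<Rightarrow> real^4" where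
  "J_rot \<kappa> \<tau> F N X p = wedge_tau \<kappa> \<tau> (F p) (N p) (X p)"

definition helix_surface ::
    "real \<Rightarrow> real \<Rightarrow> 'm topology \<Rightarrow> 'm chart set \<Rightarrow> ('m \<Rightarrow> real^4) \<Rightarrow> real \<Rightarrow> ('m \<Rightarrow> real^4) \<Rightarrow> real \<Rightarrow> bool"
  where
  "helix_surface \<kappa> \<tau> S Atl F lam N \<nu> \<longleftrightarrow>
     smooth_surface S Atl \<and> pseudo_riemannian_immersion \<kappa> \<tau> S Atl F \<and>
     unit_normal \<kappa> \<tau> S Atl F lam N \<and>
     (\<forall>p\<in>topspace S. angle_function \<kappa> \<tau> F lam N p = \<nu>)"

end

theory Submission
  imports Defs
begin

text \<open>Write \<open>N = - \<lambda> \<nu> E\<^sub>1 + n\<^sub>2 E\<^sub>2 + n\<^sub>3 E\<^sub>3\<close>.  As \<open>\<nu>\<close> is constant, so is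
  \<open>n\<^sub>2\<^sup>2 + n\<^sub>3\<^sup>2 = \<lambda> + \<nu>\<^sup>2\<close>, and the only unknown is the differential \<open>\<theta>\<close> of the angle of
  \<open>(n\<^sub>2, n\<^sub>3)\<close>.  Both \<open>T\<close> and \<open>JT\<close> have explicit components in the frame, hence so does their
  bracket, computed by applying it to the coordinate functions of the immersion.  Tangency of
  \<open>[T, JT]\<close> determines \<open>\<theta>(T)\<close>, and \<open>\<mu> = \<theta>(JT)\<close> turns out to be the remaining entry of the shape
  operator.  A torsion-free connection for which \<open>T\<close> and \<open>JT\<close> are orthogonal of constant length is
  determined by \<open>[T, JT]\<close>; this gives (ii).  The equation for \<open>\<mu>\<close> is \<open>d\<theta> = 0\<close>, i.e. the bracket
  identity applied to \<open>n\<^sub>2\<close> and \<open>n\<^sub>3\<close>, and with it the curvature follows from the connection form.\<close>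

section \<open>Smooth maps\<close>

text \<open>The connections are known only through axioms on globally defined fields, so the
  argument works with global frames throughout. In the ambient space \<open>E1\<close>,
  \<open>E2\<close>, \<open>E3\<close> are restrictions of linear maps: the derivative of
  \<open>E2 \<kappa> (F q)\<close> along v is \<open>E2 \<kappa> v\<close>, and similarly for the
  others, so brackets become matrix algebra. On the surface \<open>T\<close> and \<open>JT\<close>
  serve as the frame. Their squared lengths are \<open>- lam * r\<close> and \<open>r\<close>, so
  \<open>r\<close> must not vanish; for \<open>r = 0\<close> the surface would be tangent to the
  span of \<open>E2\<close> and \<open>E3\<close>, which is not integrable. Smoothness of a
  derivative of a function along a field is read off from \<open>D\<close>, which maps fields to
  fields; this shapes the definition of \<open>\<mu>\<close> and the curvature proof. The curvature
  is intrinsic: if D_X T = eta(X) JT, then D_X JT = lam eta(X) T, and only the exterior derivative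
  of eta remains. The ambient connection enters in (i), through its values on the frame.\<close>

lemma Ck_on_cong_imp:
  assumes "open S" "\<And>x. x \<in> S \<Longrightarrow> f x = g x" "Ck_on n f S"
  shows "Ck_on n g S"
  using assms(2,3)
proof (induction n arbitrary: f g)
  case 0
  then show ?case by (simp cong: continuous_on_cong)
next
  case (Suc n)
  have d: "frechet_derivative f (at x) = frechet_derivative g (at x)" "g differentiable (at x)"
    if "x \<in> S" for x
  proof -
    have "(f has_derivative f') (at x) \<longleftrightarrow> (g has_derivative f') (at x)" for f'
      using has_derivative_transform_within_open[OF _ assms(1) that, of f f' UNIV g]
        has_derivative_transform_within_open[OF _ assms(1) that, of g f' UNIV f] Suc.prems(1)
      by auto
    moreover have "f differentiable (at x)" using Suc.prems(2) that by simp
    ultimately show "frechet_derivative f (at x) = frechet_derivative g (at x)"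
        "g differentiable (at x)"
      by (simp_all add: frechet_derivative_def differentiable_def)
  qed
  show ?case
    using Suc.IH[of "\<lambda>x. frechet_derivative f (at x) v" "\<lambda>x. frechet_derivative g (at x) v" for v]
      Suc.prems(2) d by auto
qed

text \<open>\<open>Ck_on\<close> is phrased with \<open>frechet_derivative\<close>; this form
  accepts any explicit derivative, so each closure rule below reduces to the usual rule of
  differentiation.\<close>

lemma Ck_on_SucI:
  assumes "open S" "\<And>x. x \<in> S \<Longrightarrow> (f has_derivative f' x) (at x)"
    "\<And>v. Ck_on n (\<lambda>x. f' x v) S"
  shows "Ck_on (Suc n) f S"
proof -
  have "Ck_on n (\<lambda>x. frechet_derivative f (at x) v) S" for v
    by (rule Ck_on_cong_imp[OF assms(1) _ assms(3)[of v]])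
       (simp add: frechet_derivative_at[OF assms(2), symmetric])
  then show ?thesis using assms(2) by (auto simp: differentiable_def)
qed

text \<open>Needed for the Leibniz rule in \<open>Ck_on_bilinear\<close>, where an undifferentiated
  factor of order \<open>Suc n\<close> stands next to a differentiated one of order
  \<open>n\<close>.\<close>

lemma Ck_on_Suc_imp: "Ck_on (Suc n) f S \<Longrightarrow> Ck_on n f S"
proof (induction n arbitrary: f)
  case 0
  then have "\<forall>x\<in>S. isCont f x" by (auto simp: differentiable_imp_continuous_within)
  then show ?case by (simp add: continuous_at_imp_continuous_on)
next
  case (Suc n)
  have "Ck_on n (\<lambda>x. frechet_derivative f (at x) v) S" for v
    using Suc.prems by (intro Suc.IH[of "\<lambda>x. frechet_derivative f (at x) v"]) simp
  then show ?case using Suc.prems by simp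
qed

lemma Ck_on_const: "open S \<Longrightarrow> Ck_on n (\<lambda>x. c) S"
  by (induction n arbitrary: c) (auto intro!: Ck_on_SucI[of S _ "\<lambda>x v. 0"] simp del: Ck_on.simps(2))

lemma Ck_on_bounded_linear:
  assumes L: "bounded_linear L" and "open S" "Ck_on n f S"
  shows "Ck_on n (\<lambda>x. L (f x)) S"
  using assms(3)
proof (induction n arbitrary: f)
  case 0
  then show ?case using L by (simp add: bounded_linear.continuous_on)
next
  case (Suc n)
  then show ?case
    by (intro Ck_on_SucI[OF assms(2), of _ "\<lambda>x v. L (frechet_derivative f (at x) v)"])
       (auto intro!: bounded_linear.has_derivative[OF L] simp: frechet_derivative_works)
qed

lemma Ck_on_add:
  assumes "open S" "Ck_on n f S" "Ck_on n g S"
  shows "Ck_on n (\<lambda>x. f x + g x) S"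
  using assms(2,3)
proof (induction n arbitrary: f g)
  case 0
  then show ?case by (simp add: continuous_on_add)
next
  case (Suc n)
  then show ?case
    by (intro Ck_on_SucI[OF assms(1), of _
          "\<lambda>x v. frechet_derivative f (at x) v + frechet_derivative g (at x) v"])
       (auto intro!: has_derivative_add simp: frechet_derivative_works)
qed

lemma Ck_on_bilinear:
  assumes B: "bounded_bilinear B" and "open S" "Ck_on n f S" "Ck_on n g S"
  shows "Ck_on n (\<lambda>x. B (f x) (g x)) S"
  using assms(3,4)
proof (induction n arbitrary: f g)
  case 0
  then show ?case using B by (simp add: bounded_bilinear.continuous_on)
next
  case (Suc n)
  show ?case
  proof (rule Ck_on_SucI[OF assms(2), of _
          "\<lambda>x v. B (f x) (frechet_derivative g (at x) v) + B (frechet_derivative f (at x) v) (g x)"])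
    show "((\<lambda>x. B (f x) (g x)) has_derivative
        (\<lambda>v. B (f x) (frechet_derivative g (at x) v) + B (frechet_derivative f (at x) v) (g x))) (at x)"
      if "x \<in> S" for x
      using Suc.prems that
      by (intro bounded_bilinear.FDERIV[OF B]) (auto simp: frechet_derivative_works)
    show "Ck_on n (\<lambda>x. B (f x) (frechet_derivative g (at x) v)
        + B (frechet_derivative f (at x) v) (g x)) S" for v
      using Suc.prems Ck_on_Suc_imp[OF Suc.prems(1)] Ck_on_Suc_imp[OF Suc.prems(2)]
      by (intro Ck_on_add[OF assms(2)] Suc.IH) auto
  qed
qed

lemma Ck_on_id: "open S \<Longrightarrow> Ck_on n (\<lambda>x. x) S"
proof (cases n)
  case (Suc m)
  assume "open S"
  then show ?thesis unfolding Suc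
    by (intro Ck_on_SucI[of S _ "\<lambda>x v. v"] Ck_on_const) auto
qed auto

section \<open>The frame of the Berger-like space\<close>

lemma vector_4 [simp]:
  "(vector [a, b, c, d] :: 'a::zero^4) $ 1 = a" "(vector [a, b, c, d] :: 'a^4) $ 2 = b"
  "(vector [a, b, c, d] :: 'a^4) $ 3 = c" "(vector [a, b, c, d] :: 'a^4) $ 4 = d"
  unfolding vector_def by simp_all

lemma vec4_eq_iff: "(x::real^4) = y \<longleftrightarrow> x$1 = y$1 \<and> x$2 = y$2 \<and> x$3 = y$3 \<and> x$4 = y$4"
  by (simp add: vec_eq_iff forall_4)

lemma frame_nth:
  "E1 \<kappa> \<tau> x $ 1 = - sqrt \<kappa> / (2 * \<tau>) * x$2" "E1 \<kappa> \<tau> x $ 2 = sqrt \<kappa> / (2 * \<tau>) * x$1"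
  "E1 \<kappa> \<tau> x $ 3 = - sqrt \<kappa> / (2 * \<tau>) * x$4" "E1 \<kappa> \<tau> x $ 4 = sqrt \<kappa> / (2 * \<tau>) * x$3"
  "E2 \<kappa> x $ 1 = sqrt \<kappa> / 2 * x$3" "E2 \<kappa> x $ 2 = - sqrt \<kappa> / 2 * x$4"
  "E2 \<kappa> x $ 3 = sqrt \<kappa> / 2 * x$1" "E2 \<kappa> x $ 4 = - sqrt \<kappa> / 2 * x$2"
  "E3 \<kappa> x $ 1 = sqrt \<kappa> / 2 * x$4" "E3 \<kappa> x $ 2 = sqrt \<kappa> / 2 * x$3"
  "E3 \<kappa> x $ 3 = sqrt \<kappa> / 2 * x$2" "E3 \<kappa> x $ 4 = sqrt \<kappa> / 2 * x$1"
  by (simp_all add: E1_def E2_def E3_def X1_def X2_def X3_def J1_def J2_def J3_def)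

lemma X1_nth:
  "X1 \<kappa> x $ 1 = - sqrt \<kappa> / 2 * x$2" "X1 \<kappa> x $ 2 = sqrt \<kappa> / 2 * x$1"
  "X1 \<kappa> x $ 3 = - sqrt \<kappa> / 2 * x$4" "X1 \<kappa> x $ 4 = sqrt \<kappa> / 2 * x$3"
  by (simp_all add: X1_def J1_def)

lemma linear_frame: "linear (E1 \<kappa> \<tau>)" "linear (E2 \<kappa>)" "linear (E3 \<kappa>)"
  by (intro linearI; simp add: vec4_eq_iff frame_nth algebra_simps add_divide_distrib)+

lemmas frame_linear [simp] =
  linear_add[OF linear_frame(1)] linear_add[OF linear_frame(2)] linear_add[OF linear_frame(3)]
  linear_diff[OF linear_frame(1)] linear_diff[OF linear_frame(2)] linear_diff[OF linear_frame(3)]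
  linear_scale[OF linear_frame(1)] linear_scale[OF linear_frame(2)] linear_scale[OF linear_frame(3)]
  linear_neg[OF linear_frame(1)] linear_neg[OF linear_frame(2)] linear_neg[OF linear_frame(3)]

lemma g_tau_linear:
  "g_tau \<kappa> \<tau> q (u + u') v = g_tau \<kappa> \<tau> q u v + g_tau \<kappa> \<tau> q u' v"
  "g_tau \<kappa> \<tau> q (u - u') v = g_tau \<kappa> \<tau> q u v - g_tau \<kappa> \<tau> q u' v"
  "g_tau \<kappa> \<tau> q u (v + v') = g_tau \<kappa> \<tau> q u v + g_tau \<kappa> \<tau> q u v'"
  "g_tau \<kappa> \<tau> q u (v - v') = g_tau \<kappa> \<tau> q u v - g_tau \<kappa> \<tau> q u v'"
  "g_tau \<kappa> \<tau> q (a *\<^sub>R u) v = a * g_tau \<kappa> \<tau> q u v"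
  "g_tau \<kappa> \<tau> q u (a *\<^sub>R v) = a * g_tau \<kappa> \<tau> q u v"
  "g_tau \<kappa> \<tau> q (- u) v = - g_tau \<kappa> \<tau> q u v"
  "g_tau \<kappa> \<tau> q u (- v) = - g_tau \<kappa> \<tau> q u v"
  "g_tau \<kappa> \<tau> q 0 v = 0" "g_tau \<kappa> \<tau> q u 0 = 0"
  by (simp_all add: g_tau_def g0_def algebra_simps)

lemma g_tau_commute: "g_tau \<kappa> \<tau> q u v = g_tau \<kappa> \<tau> q v u"
  by (simp add: g_tau_def g0_def algebra_simps)

lemma subspace_AdS_tangent: "subspace (AdS_tangent q)"
  by (auto simp: subspace_def AdS_tangent_def g0_def algebra_simps)
   (metis distrib_left)

lemma frame_tangent: "E1 \<kappa> \<tau> q \<in> AdS_tangent q" "E2 \<kappa> q \<in> AdS_tangent q" "E3 \<kappa> q \<in> AdS_tangent q"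
  by (simp_all add: AdS_tangent_def g0_def frame_nth)

context
  fixes \<kappa> \<tau> :: real and q :: "real^4"
  assumes pos: "\<kappa> > 0" "\<tau> > 0" and q: "q \<in> AdS \<kappa>"
begin

lemma quadric: "\<kappa> * (q$1 * q$1 + q$2 * q$2 - q$3 * q$3 - q$4 * q$4) = - 4"
  using q pos by (simp add: AdS_def g0_def field_simps)

lemma g0_frame:
  "g0 (X1 \<kappa> q) (X1 \<kappa> q) = - 1" "g0 (E2 \<kappa> q) (E2 \<kappa> q) = 1" "g0 (E3 \<kappa> q) (E3 \<kappa> q) = 1"
proof -
  \<comment> \<open>With \<open>s * s\<close> equal to \<kappa>/4 the square root becomes a
    polynomial variable. \<open>J1\<close> preserves \<open>g0\<close> while \<open>J2\<close> and
    \<open>J3\<close> reverse its sign, so all three values come from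
    \<open>g0 q q = - 4 / \<kappa>\<close>.\<close>
  define s where "s = sqrt \<kappa> / 2"
  have "\<kappa> = 4 * (s * s)" using pos by (simp add: s_def)
  then have "s * s * (q$1 * q$1 + q$2 * q$2 - q$3 * q$3 - q$4 * q$4) = - 1"
    using quadric by simp
  then show "g0 (X1 \<kappa> q) (X1 \<kappa> q) = - 1" "g0 (E2 \<kappa> q) (E2 \<kappa> q) = 1" "g0 (E3 \<kappa> q) (E3 \<kappa> q) = 1"
    by (simp_all add: g0_def X1_nth frame_nth s_def[symmetric]) algebra+
qed

lemma g0_frame_orthogonal:
  "g0 (X1 \<kappa> q) (E2 \<kappa> q) = 0" "g0 (E2 \<kappa> q) (X1 \<kappa> q) = 0" "g0 (X1 \<kappa> q) (E3 \<kappa> q) = 0"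
  "g0 (E3 \<kappa> q) (X1 \<kappa> q) = 0" "g0 (E2 \<kappa> q) (E3 \<kappa> q) = 0" "g0 (E3 \<kappa> q) (E2 \<kappa> q) = 0"
  by (simp_all add: g0_def X1_nth frame_nth)

lemma g_tau_E:
  "g_tau \<kappa> \<tau> q v (E1 \<kappa> \<tau> q) = \<tau> * g0 v (X1 \<kappa> q)"
  "g_tau \<kappa> \<tau> q v (E2 \<kappa> q) = g0 v (E2 \<kappa> q)"
  "g_tau \<kappa> \<tau> q v (E3 \<kappa> q) = g0 v (E3 \<kappa> q)"
proof -
  have "g_tau \<kappa> \<tau> q v (X1 \<kappa> q) = \<tau> * \<tau> * g0 v (X1 \<kappa> q)"
    by (simp add: g_tau_def g0_frame power2_eq_square algebra_simps)
  then show "g_tau \<kappa> \<tau> q v (E1 \<kappa> \<tau> q) = \<tau> * g0 v (X1 \<kappa> q)"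
    using pos by (simp add: E1_def g_tau_linear)
qed (simp_all add: g_tau_def g0_frame_orthogonal)

lemma frame_orthonormal:
  "g_tau \<kappa> \<tau> q (E1 \<kappa> \<tau> q) (E1 \<kappa> \<tau> q) = - 1" "g_tau \<kappa> \<tau> q (E2 \<kappa> q) (E2 \<kappa> q) = 1"
  "g_tau \<kappa> \<tau> q (E3 \<kappa> q) (E3 \<kappa> q) = 1" "g_tau \<kappa> \<tau> q (E1 \<kappa> \<tau> q) (E2 \<kappa> q) = 0"
  "g_tau \<kappa> \<tau> q (E2 \<kappa> q) (E1 \<kappa> \<tau> q) = 0" "g_tau \<kappa> \<tau> q (E1 \<kappa> \<tau> q) (E3 \<kappa> q) = 0"
  "g_tau \<kappa> \<tau> q (E3 \<kappa> q) (E1 \<kappa> \<tau> q) = 0" "g_tau \<kappa> \<tau> q (E2 \<kappa> q) (E3 \<kappa> q) = 0"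
  "g_tau \<kappa> \<tau> q (E3 \<kappa> q) (E2 \<kappa> q) = 0"
proof -
  have "E1 \<kappa> \<tau> q = (1 / \<tau>) *\<^sub>R X1 \<kappa> q" by (simp add: E1_def)
  then show "g_tau \<kappa> \<tau> q (E1 \<kappa> \<tau> q) (E1 \<kappa> \<tau> q) = - 1" "g_tau \<kappa> \<tau> q (E1 \<kappa> \<tau> q) (E2 \<kappa> q) = 0"
    "g_tau \<kappa> \<tau> q (E1 \<kappa> \<tau> q) (E3 \<kappa> q) = 0"
    using pos g_tau_E[of "X1 \<kappa> q"] by (simp_all add: g_tau_linear g0_frame g0_frame_orthogonal)
qed (simp_all add: g_tau_E g0_frame g0_frame_orthogonal)

text \<open>Together with the position vector \<open>q\<close> the fields \<open>X1\<close>,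
  \<open>E2\<close>, \<open>E3\<close> form a \<open>g0\<close>-orthogonal basis of the ambient
  space, and tangency removes the component along \<open>q\<close>. The first coefficient carries a
  minus sign because \<open>E1\<close> is timelike.\<close>

lemma frame_expansion:
  assumes "v \<in> AdS_tangent q"
  shows "v = (- g_tau \<kappa> \<tau> q v (E1 \<kappa> \<tau> q)) *\<^sub>R E1 \<kappa> \<tau> q + g_tau \<kappa> \<tau> q v (E2 \<kappa> q) *\<^sub>R E2 \<kappa> q
    + g_tau \<kappa> \<tau> q v (E3 \<kappa> q) *\<^sub>R E3 \<kappa> q"
proof -
  define s where "s = sqrt \<kappa> / 2"
  have "\<kappa> = 4 * (s * s)" using pos by (simp add: s_def)
  then have Q: "s * s * (q$1 * q$1 + q$2 * q$2 - q$3 * q$3 - q$4 * q$4) = - 1"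
    using quadric by simp
  have t: "q$1 * v$1 + q$2 * v$2 - q$3 * v$3 - q$4 * v$4 = 0"
    using assms by (simp add: AdS_tangent_def g0_def)
  have "v = (- g0 v (X1 \<kappa> q)) *\<^sub>R X1 \<kappa> q + g0 v (E2 \<kappa> q) *\<^sub>R E2 \<kappa> q + g0 v (E3 \<kappa> q) *\<^sub>R E3 \<kappa> q"
    unfolding vec4_eq_iff using Q t
    by (simp add: g0_def X1_nth frame_nth s_def[symmetric]) algebra
  moreover have "X1 \<kappa> q = \<tau> *\<^sub>R E1 \<kappa> \<tau> q" using pos by (simp add: E1_def)
  ultimately show ?thesis by (simp add: g_tau_E mult.commute)
qed

lemma frame_eqI:
  assumes "u \<in> AdS_tangent q" "v \<in> AdS_tangent q"
    "g_tau \<kappa> \<tau> q u (E1 \<kappa> \<tau> q) = g_tau \<kappa> \<tau> q v (E1 \<kappa> \<tau> q)"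
    "g_tau \<kappa> \<tau> q u (E2 \<kappa> q) = g_tau \<kappa> \<tau> q v (E2 \<kappa> q)"
    "g_tau \<kappa> \<tau> q u (E3 \<kappa> q) = g_tau \<kappa> \<tau> q v (E3 \<kappa> q)"
  shows "u = v"
  using frame_expansion[OF assms(1)] frame_expansion[OF assms(2)] assms(3-5) by simp

end

text \<open>The maps \<open>J1\<close>, \<open>J2\<close>, \<open>J3\<close> multiply like the units
  of the split quaternions: J1 J2 = J3, J2 J3 = - J1, J3 J1 = J2, and distinct ones anticommute. The
  coefficients only record the normalisation of the frame.\<close>

lemma frame_compose:
  assumes "\<kappa> > 0" "\<tau> > 0"
  shows "E1 \<kappa> \<tau> (E2 \<kappa> x) = (sqrt \<kappa> / (2 * \<tau>)) *\<^sub>R E3 \<kappa> x"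
    "E2 \<kappa> (E1 \<kappa> \<tau> x) = - (sqrt \<kappa> / (2 * \<tau>)) *\<^sub>R E3 \<kappa> x"
    "E2 \<kappa> (E3 \<kappa> x) = - (sqrt \<kappa> * \<tau> / 2) *\<^sub>R E1 \<kappa> \<tau> x"
    "E3 \<kappa> (E2 \<kappa> x) = (sqrt \<kappa> * \<tau> / 2) *\<^sub>R E1 \<kappa> \<tau> x"
    "E3 \<kappa> (E1 \<kappa> \<tau> x) = (sqrt \<kappa> / (2 * \<tau>)) *\<^sub>R E2 \<kappa> x"
    "E1 \<kappa> \<tau> (E3 \<kappa> x) = - (sqrt \<kappa> / (2 * \<tau>)) *\<^sub>R E2 \<kappa> x"
  using assms by (simp_all add: vec4_eq_iff frame_nth field_simps)

section \<open>The ambient connection\<close>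

text \<open>Normalising the line \<open>q + s v\<close> gives a curve in the quadric with velocity \<open>v\<close>.\<close>

lemma AdS_derivative:
  fixes f :: "real^4 \<Rightarrow> real"
  assumes "\<kappa> > 0" "q \<in> AdS \<kappa>" "v \<in> AdS_tangent q"
    and D: "(f has_derivative D) (at q within AdS \<kappa>)"
  shows "frechet_derivative f (at q within AdS \<kappa>) v = D v"
proof -
  \<comment> \<open>On the line \<open>q + s *\<^sub>R v\<close> the form \<open>g0\<close> takes
    the value - 4/\<kappa> (1 - a s^2), so scaling by \<open>h s\<close> returns to the quadric as
    long as \<open>s\<close> lies in \<open>X\<close>. Since \<open>h\<close> has derivative 0 at 0,
    the velocity there stays \<open>v\<close>.\<close>
  define a where "a = \<kappa> / 4 * g0 v v"
  define h where "h = (\<lambda>s::real. 1 / sqrt (1 - a * s\<^sup>2))"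
  define c where "c = (\<lambda>s. h s *\<^sub>R (q + s *\<^sub>R v))"
  define X where "X = {s::real. 1 - a * s\<^sup>2 > 0}"
  have X: "open X" "0 \<in> X"
    unfolding X_def by (auto intro!: open_Collect_less continuous_intros)
  have c0: "c 0 = q" by (simp add: c_def h_def)
  have c: "c ` X \<subseteq> AdS \<kappa>"
  proof safe
    fix s assume "s \<in> X"
    then have s: "1 - a * s\<^sup>2 > 0" by (simp add: X_def)
    have "g0 q v = 0" using assms(3) by (simp add: AdS_tangent_def)
    then have "g0 (q + s *\<^sub>R v) (q + s *\<^sub>R v) = g0 q q + s\<^sup>2 * g0 v v"
      unfolding g0_def by (simp add: algebra_simps power2_eq_square) algebra
    also have "\<dots> = - 4 / \<kappa> * (1 - a * s\<^sup>2)"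
      using assms(1,2) by (simp add: AdS_def a_def field_simps)
    finally have Q: "g0 (q + s *\<^sub>R v) (q + s *\<^sub>R v) = - 4 / \<kappa> * (1 - a * s\<^sup>2)" .
    have scale: "g0 (k *\<^sub>R x) (k *\<^sub>R x) = k\<^sup>2 * g0 x x" for k x
      by (simp add: g0_def algebra_simps power2_eq_square)
    have "g0 (c s) (c s) = (h s)\<^sup>2 * (- 4 / \<kappa> * (1 - a * s\<^sup>2))"
      unfolding c_def scale Q ..
    also have "(h s)\<^sup>2 = 1 / (1 - a * s\<^sup>2)"
      using s by (simp add: h_def power_divide)
    also have "1 / (1 - a * s\<^sup>2) * (- 4 / \<kappa> * (1 - a * s\<^sup>2)) = - 4 / \<kappa>"
      using s by (metis less_irrefl mult.commute nonzero_divide_eq_eq mult_1 times_divide_eq_left)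
    finally show "c s \<in> AdS \<kappa>" by (simp add: AdS_def)
  qed
  have "(h has_real_derivative 0) (at 0)"
    unfolding h_def by (auto intro!: derivative_eq_intros)
  then have "(c has_derivative (\<lambda>t. t *\<^sub>R v)) (at 0)"
    unfolding c_def has_field_derivative_def
    by (auto intro!: derivative_eq_intros simp: h_def)
  then have cd: "(c has_derivative (\<lambda>t. t *\<^sub>R v)) (at 0 within X)"
    by (rule has_derivative_at_withinI)
  \<comment> \<open>Composition with the curve turns both candidates into derivatives of one
    function of a real variable, where derivatives are unique.\<close>
  have "D2 v = D v" if "(f has_derivative D2) (at q within AdS \<kappa>)" for D2
  proof -
    have comp: "(f \<circ> c has_derivative L \<circ> (\<lambda>t. t *\<^sub>R v)) (at 0)"
      if "(f has_derivative L) (at q within AdS \<kappa>)" for L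
      using diff_chain_within[OF cd, of f L] has_derivative_subset[OF that c] X
      by (simp add: c0 at_within_open[of 0 X])
    show ?thesis
      using fun_cong[OF has_derivative_unique[OF comp[OF that] comp[OF D]], of 1] by simp
  qed
  moreover have "(f has_derivative frechet_derivative f (at q within AdS \<kappa>)) (at q within AdS \<kappa>)"
    using D by (auto simp: frechet_derivative_works[symmetric] differentiable_def)
  ultimately show ?thesis by blast
qed

text \<open>Covers every ambient derivative that is needed: coordinates of linear fields
  (\<open>k = 0\<close>) and functions constant on the quadric (\<open>L = 0\<close>).\<close>

lemma AdS_derivative_linear:
  assumes "\<kappa> > 0" "q \<in> AdS \<kappa>" "v \<in> AdS_tangent q" "linear L" "\<And>x. x \<in> AdS \<kappa> \<Longrightarrow> f x = (L x :: real) + k"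
  shows "frechet_derivative f (at q within AdS \<kappa>) v = L v"
proof (rule AdS_derivative[OF assms(1-3)])
  have "((\<lambda>x. L x + k) has_derivative L) (at q within AdS \<kappa>)"
    using assms(4) by (auto intro!: derivative_eq_intros linear_imp_has_derivative)
  then show "(f has_derivative L) (at q within AdS \<kappa>)"
    using assms(2,5) by (auto intro: has_derivative_transform)
qed

lemma AdS_smooth_linear:
  fixes f :: "real^4 \<Rightarrow> 'b::real_normed_vector"
  assumes "linear f" shows "AdS_smooth \<kappa> f"
  using Ck_on_bounded_linear[OF linear_conv_bounded_linear[THEN iffD1, OF assms] open_UNIV Ck_on_id[OF open_UNIV]]
  by (auto simp: AdS_smooth_def Cinf_on_def)

lemma AdS_smooth_const: "AdS_smooth \<kappa> (\<lambda>x. c)"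
  using Ck_on_const[OF open_UNIV, of _ c] by (auto simp: AdS_smooth_def Cinf_on_def)

text \<open>The set allows the axioms of \<open>DH\<close> to be specialised once, for arbitrary
  members, instead of separately for each choice of frame fields.\<close>

definition frame_fields :: "real \<Rightarrow> real \<Rightarrow> (real^4 \<Rightarrow> real^4) set" where
  "frame_fields \<kappa> \<tau> = {E1 \<kappa> \<tau>, E2 \<kappa>, E3 \<kappa>}"

lemma frame_fields_linear: "X \<in> frame_fields \<kappa> \<tau> \<Longrightarrow> linear X"
  by (auto simp: frame_fields_def linear_frame)

lemma frame_fields_tangent: "X \<in> frame_fields \<kappa> \<tau> \<Longrightarrow> X q \<in> AdS_tangent q"
  by (auto simp: frame_fields_def frame_tangent)

lemma frame_fields_flds: "X \<in> frame_fields \<kappa> \<tau> \<Longrightarrow> X \<in> flds (AdS_geometry \<kappa> \<tau>)"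
  by (simp add: AdS_geometry_def AdS_smooth_linear frame_fields_linear frame_fields_tangent)

locale ambient_connection =
  fixes \<kappa> \<tau> :: real and DH :: "(real^4 \<Rightarrow> real^4) \<Rightarrow> (real^4 \<Rightarrow> real^4) \<Rightarrow> real^4 \<Rightarrow> real^4"
  assumes kappa_pos: "\<kappa> > 0" and tau_pos: "\<tau> > 0"
    and DH: "levi_civita (AdS_geometry \<kappa> \<tau>) DH"
begin

lemma DH_frame_tangent:
  assumes "X \<in> frame_fields \<kappa> \<tau>" "Y \<in> frame_fields \<kappa> \<tau>" "q \<in> AdS \<kappa>"
  shows "DH X Y q \<in> AdS_tangent q"
proof -
  let ?H = "AdS_geometry \<kappa> \<tau>"
  have "\<forall>X\<in>flds ?H. \<forall>Y\<in>flds ?H. DH X Y \<in> flds ?H"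
    using DH unfolding levi_civita_def affine_connection_def by (elim conjE)
  then have "DH X Y \<in> flds ?H"
    using assms(1,2)[THEN frame_fields_flds] by blast
  then show ?thesis using assms(3) by (simp add: AdS_geometry_def)
qed

text \<open>Inner products of frame fields are constant on the quadric, so metric compatibility
  differentiates a constant.\<close>

lemma DH_metric:
  assumes "X \<in> frame_fields \<kappa> \<tau>" "Y \<in> frame_fields \<kappa> \<tau>" "Z \<in> frame_fields \<kappa> \<tau>" "q \<in> AdS \<kappa>"
  shows "g_tau \<kappa> \<tau> q (DH X Y q) (Z q) + g_tau \<kappa> \<tau> q (Y q) (DH X Z q) = 0"
proof -
  let ?H = "AdS_geometry \<kappa> \<tau>"
  obtain k where "\<And>x. x \<in> AdS \<kappa> \<Longrightarrow> g_tau \<kappa> \<tau> x (Y x) (Z x) = k"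
    using assms(2,3) frame_orthonormal[OF kappa_pos tau_pos]
    by (auto simp: frame_fields_def)
  then have "frechet_derivative (\<lambda>x. g_tau \<kappa> \<tau> x (Y x) (Z x)) (at q within AdS \<kappa>) (X q) = 0"
    by (intro AdS_derivative_linear[where L = "\<lambda>_. 0" and k = k])
       (auto simp: kappa_pos assms frame_fields_tangent[OF assms(1)] linear_iff)
  moreover have "\<forall>X\<in>flds ?H. \<forall>Y\<in>flds ?H. \<forall>Z\<in>flds ?H. \<forall>p\<in>pts ?H.
        dif ?H (\<lambda>q. met ?H q (Y q) (Z q)) p (X p) =
          met ?H p (DH X Y p) (Z p) + met ?H p (Y p) (DH X Z p)"
    using DH unfolding levi_civita_def by (elim conjE)
  ultimately show ?thesis
    using assms(1-3)[THEN frame_fields_flds] assms(4) by (simp add: AdS_geometry_def)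
qed

text \<open>Testing the bracket on the coordinate functions recovers it as a vector. Since
  \<open>Y\<close> is linear, its derivative along \<open>X\<close> is \<open>Y\<close> applied to
  \<open>X q\<close>.\<close>

lemma DH_torsion:
  assumes "X \<in> frame_fields \<kappa> \<tau>" "Y \<in> frame_fields \<kappa> \<tau>" "q \<in> AdS \<kappa>"
  shows "DH X Y q - DH Y X q = Y (X q) - X (Y q)"
proof -
  let ?H = "AdS_geometry \<kappa> \<tau>"
  let ?d = "\<lambda>f q. frechet_derivative f (at q within AdS \<kappa>)"
  have coord: "?d (\<lambda>x. x $ i) x v = v $ i" if "x \<in> AdS \<kappa>" "v \<in> AdS_tangent x" for x v i
    using that by (intro AdS_derivative_linear[where k = 0])
      (auto simp: kappa_pos intro: bounded_linear.linear bounded_linear_vec_nth)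
  have coord2: "?d (\<lambda>x. ?d (\<lambda>x. x $ i) x (Z x)) q (V q) = Z (V q) $ i"
    if "V \<in> frame_fields \<kappa> \<tau>" "Z \<in> frame_fields \<kappa> \<tau>" for V Z i
    using frame_fields_linear[OF that(2)]
    by (intro AdS_derivative_linear[where k = 0])
      (auto simp: kappa_pos assms coord frame_fields_tangent[OF that(1)] frame_fields_tangent[OF that(2)]
        linear_iff)
  have "is_lie_bracket ?H X Y (\<lambda>p. DH X Y p - DH Y X p)"
    using DH assms(1,2)[THEN frame_fields_flds] unfolding levi_civita_def by blast
  then have "?d (\<lambda>x. x $ i) q (DH X Y q - DH Y X q)
      = ?d (\<lambda>x. ?d (\<lambda>x. x $ i) x (Y x)) q (X q) - ?d (\<lambda>x. ?d (\<lambda>x. x $ i) x (X x)) q (Y q)" for i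
    using assms(3) AdS_smooth_linear[OF bounded_linear.linear[OF bounded_linear_vec_nth[of i]]]
    unfolding is_lie_bracket_def by (simp add: AdS_geometry_def)
  moreover have "DH X Y q - DH Y X q \<in> AdS_tangent q"
    using assms by (intro subspace_diff subspace_AdS_tangent DH_frame_tangent)
  ultimately show ?thesis
    using assms by (simp add: vec_eq_iff coord coord2)
qed

text \<open>This is the Koszul formula as linear algebra: metric compatibility gives 18 and
  vanishing torsion 9 linear equations for the 27 frame components of the nine covariant
  derivatives, and these determine them.\<close>

lemma DH_frame:
  assumes q: "q \<in> AdS \<kappa>"
  shows "DH (E1 \<kappa> \<tau>) (E1 \<kappa> \<tau>) q = 0"
    "DH (E2 \<kappa>) (E1 \<kappa> \<tau>) q = (sqrt \<kappa> * \<tau> / 2) *\<^sub>R E3 \<kappa> q"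
    "DH (E3 \<kappa>) (E1 \<kappa> \<tau>) q = - (sqrt \<kappa> * \<tau> / 2) *\<^sub>R E2 \<kappa> q"
    "DH (E1 \<kappa> \<tau>) (E2 \<kappa>) q = (sqrt \<kappa> * \<tau> / 2 - sqrt \<kappa> / \<tau>) *\<^sub>R E3 \<kappa> q"
    "DH (E2 \<kappa>) (E2 \<kappa>) q = 0"
    "DH (E3 \<kappa>) (E2 \<kappa>) q = - (sqrt \<kappa> * \<tau> / 2) *\<^sub>R E1 \<kappa> \<tau> q"
    "DH (E1 \<kappa> \<tau>) (E3 \<kappa>) q = - (sqrt \<kappa> * \<tau> / 2 - sqrt \<kappa> / \<tau>) *\<^sub>R E2 \<kappa> q"
    "DH (E2 \<kappa>) (E3 \<kappa>) q = (sqrt \<kappa> * \<tau> / 2) *\<^sub>R E1 \<kappa> \<tau> q"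
    "DH (E3 \<kappa>) (E3 \<kappa>) q = 0"
proof -
  have in_frame: "E1 \<kappa> \<tau> \<in> frame_fields \<kappa> \<tau>" "E2 \<kappa> \<in> frame_fields \<kappa> \<tau>" "E3 \<kappa> \<in> frame_fields \<kappa> \<tau>"
    by (simp_all add: frame_fields_def)
  note tan = DH_frame_tangent[OF _ _ q]
  note tangents = in_frame[THEN tan[OF in_frame(1)]] in_frame[THEN tan[OF in_frame(2)]]
    in_frame[THEN tan[OF in_frame(3)]] subspace_0[OF subspace_AdS_tangent]
    subspace_scale[OF subspace_AdS_tangent] frame_tangent
  note m = DH_metric[OF _ _ _ q]
  note metric = m[OF in_frame(1) in_frame(1) in_frame(1)] m[OF in_frame(1) in_frame(1) in_frame(2)]
    m[OF in_frame(1) in_frame(1) in_frame(3)] m[OF in_frame(1) in_frame(2) in_frame(2)]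
    m[OF in_frame(1) in_frame(2) in_frame(3)] m[OF in_frame(1) in_frame(3) in_frame(3)]
    m[OF in_frame(2) in_frame(1) in_frame(1)] m[OF in_frame(2) in_frame(1) in_frame(2)]
    m[OF in_frame(2) in_frame(1) in_frame(3)] m[OF in_frame(2) in_frame(2) in_frame(2)]
    m[OF in_frame(2) in_frame(2) in_frame(3)] m[OF in_frame(2) in_frame(3) in_frame(3)]
    m[OF in_frame(3) in_frame(1) in_frame(1)] m[OF in_frame(3) in_frame(1) in_frame(2)]
    m[OF in_frame(3) in_frame(1) in_frame(3)] m[OF in_frame(3) in_frame(2) in_frame(2)]
    m[OF in_frame(3) in_frame(2) in_frame(3)] m[OF in_frame(3) in_frame(3) in_frame(3)]
  note fc = frame_compose[OF kappa_pos tau_pos]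
  have g: "g_tau \<kappa> \<tau> q (DH (E1 \<kappa> \<tau>) (E2 \<kappa>) q) v - g_tau \<kappa> \<tau> q (DH (E2 \<kappa>) (E1 \<kappa> \<tau>) q) v
      = - (sqrt \<kappa> / \<tau>) * g_tau \<kappa> \<tau> q (E3 \<kappa> q) v"
    "g_tau \<kappa> \<tau> q (DH (E2 \<kappa>) (E3 \<kappa>) q) v - g_tau \<kappa> \<tau> q (DH (E3 \<kappa>) (E2 \<kappa>) q) v
      = sqrt \<kappa> * \<tau> * g_tau \<kappa> \<tau> q (E1 \<kappa> \<tau> q) v"
    "g_tau \<kappa> \<tau> q (DH (E3 \<kappa>) (E1 \<kappa> \<tau>) q) v - g_tau \<kappa> \<tau> q (DH (E1 \<kappa> \<tau>) (E3 \<kappa>) q) v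
      = - (sqrt \<kappa> / \<tau>) * g_tau \<kappa> \<tau> q (E2 \<kappa> q) v" for v
    unfolding g_tau_linear(2)[symmetric] DH_torsion[OF in_frame(1,2) q] DH_torsion[OF in_frame(2,3) q]
      DH_torsion[OF in_frame(3,1) q] fc by (simp_all only: g_tau_linear) (simp_all add: field_simps)
  \<comment> \<open>Naming the two structure constants turns the equations into linear ones over
    atoms, as \<open>linarith\<close> requires.\<close>
  define a b where ab: "a = sqrt \<kappa> / \<tau>" "b = sqrt \<kappa> * \<tau>"
  note eqs = g[of "E1 \<kappa> \<tau> q"] g[of "E2 \<kappa> q"] g[of "E3 \<kappa> q"] metric
  note eqs' = eqs[unfolded frame_orthonormal[OF kappa_pos tau_pos q]
    g_tau_commute[of _ _ q "E1 \<kappa> \<tau> q" "DH _ _ q"] g_tau_commute[of _ _ q "E2 \<kappa> q" "DH _ _ q"]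
    g_tau_commute[of _ _ q "E3 \<kappa> q" "DH _ _ q"],
    folded ab]
  note simps = g_tau_linear mult_1_right mult_zero_right frame_orthonormal[OF kappa_pos tau_pos q]
  show "DH (E1 \<kappa> \<tau>) (E1 \<kappa> \<tau>) q = 0"
    "DH (E2 \<kappa>) (E1 \<kappa> \<tau>) q = (sqrt \<kappa> * \<tau> / 2) *\<^sub>R E3 \<kappa> q"
    "DH (E3 \<kappa>) (E1 \<kappa> \<tau>) q = - (sqrt \<kappa> * \<tau> / 2) *\<^sub>R E2 \<kappa> q"
    "DH (E1 \<kappa> \<tau>) (E2 \<kappa>) q = (sqrt \<kappa> * \<tau> / 2 - sqrt \<kappa> / \<tau>) *\<^sub>R E3 \<kappa> q"
    "DH (E2 \<kappa>) (E2 \<kappa>) q = 0"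
    "DH (E3 \<kappa>) (E2 \<kappa>) q = - (sqrt \<kappa> * \<tau> / 2) *\<^sub>R E1 \<kappa> \<tau> q"
    "DH (E1 \<kappa> \<tau>) (E3 \<kappa>) q = - (sqrt \<kappa> * \<tau> / 2 - sqrt \<kappa> / \<tau>) *\<^sub>R E2 \<kappa> q"
    "DH (E2 \<kappa>) (E3 \<kappa>) q = (sqrt \<kappa> * \<tau> / 2) *\<^sub>R E1 \<kappa> \<tau> q"
    "DH (E3 \<kappa>) (E3 \<kappa>) q = 0"
    unfolding ab[symmetric]
    by (rule frame_eqI[OF kappa_pos tau_pos q]; (intro tangents)?; (simp only: simps)?; (insert eqs', linarith)?)+
qed

end

section \<open>Calculus on immersed surfaces\<close>

lemma linear_nth: "linear (\<lambda>x::real^4. x $ i)"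
  by (intro bounded_linear.linear bounded_linear_vec_nth)

lemma Cinf_on_differentiable: "Cinf_on f S \<Longrightarrow> x \<in> S \<Longrightarrow> f differentiable (at x)"
  unfolding Cinf_on_def by (drule spec[of _ "Suc 0"]) simp

locale immersed_surface =
  fixes \<kappa> \<tau> :: real and S :: "'m topology" and Atl :: "'m chart set" and F :: "'m \<Rightarrow> real^4"
  assumes kappa_pos: "\<kappa> > 0" and tau_pos: "\<tau> > 0"
    and smooth: "smooth_surface S Atl"
    and immersion: "pseudo_riemannian_immersion \<kappa> \<tau> S Atl F"
begin

abbreviation "G \<equiv> surface_geometry \<kappa> \<tau> S Atl F"
abbreviation "M \<equiv> topspace S"
abbreviation "TM \<equiv> surface_tangent Atl F"
abbreviation "sd \<equiv> surface_derivative Atl F"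
abbreviation "sm \<equiv> surface_smooth Atl"

lemma chart:
  assumes "(U, \<phi>) \<in> Atl"
  shows "openin S U" "open (\<phi> ` U)" "U \<subseteq> M" "inj_on \<phi> U"
    "homeomorphic_map (subtopology S U) (top_of_set (\<phi> ` U)) \<phi>"
proof -
  show *: "openin S U" "open (\<phi> ` U)"
      "homeomorphic_map (subtopology S U) (top_of_set (\<phi> ` U)) \<phi>"
  proof -
    have "\<forall>(U, \<phi>)\<in>Atl. openin S U \<and> open (\<phi> ` U) \<and>
        homeomorphic_map (subtopology S U) (top_of_set (\<phi> ` U)) \<phi>"
      using smooth unfolding smooth_surface_def by (elim conjE)
    from bspec[OF this assms] show "openin S U" "open (\<phi> ` U)"
      "homeomorphic_map (subtopology S U) (top_of_set (\<phi> ` U)) \<phi>" by simp_all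
  qed
  show "U \<subseteq> M" using *(1) by (rule openin_subset)
  then show "inj_on \<phi> U"
    using homeomorphic_imp_injective_map[OF *(3)] by (simp add: Int_absorb1)
qed

lemma chart_exists:
  assumes "p \<in> M"
  obtains U \<phi> where "(U, \<phi>) \<in> Atl" "p \<in> U"
proof -
  have "(\<Union>(U, \<phi>)\<in>Atl. U) = M"
    using smooth unfolding smooth_surface_def by (elim conjE)
  then have "p \<in> (\<Union>(U, \<phi>)\<in>Atl. U)" using assms by simp
  then show ?thesis using that by auto
qed

section \<open>Algebra of smooth functions on the surface\<close>

lemma smD: "sm f \<Longrightarrow> (U, \<phi>) \<in> Atl \<Longrightarrow> Ck_on n (f \<circ> inv_into U \<phi>) (\<phi> ` U)"
  by (auto simp: surface_smooth_def Cinf_on_def)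

lemma smI:
  assumes "\<And>U \<phi> n. (U, \<phi>) \<in> Atl \<Longrightarrow> open (\<phi> ` U) \<Longrightarrow> Ck_on n (\<lambda>x. f (inv_into U \<phi> x)) (\<phi> ` U)"
  shows "sm f"
  using assms chart(2) by (auto simp: surface_smooth_def Cinf_on_def o_def)

lemma sm_cong:
  assumes "\<And>p. p \<in> M \<Longrightarrow> f p = g p" "sm f"
  shows "sm g"
proof (rule smI)
  fix U \<phi> n assume c: "(U, \<phi>) \<in> Atl" "open (\<phi> ` U)"
  show "Ck_on n (\<lambda>x. g (inv_into U \<phi> x)) (\<phi> ` U)"
  proof (rule Ck_on_cong_imp[OF c(2) _ smD[OF assms(2) c(1)]])
    fix x assume "x \<in> \<phi> ` U"
    then have "inv_into U \<phi> x \<in> M" by (rule subsetD[OF chart(3)[OF c(1)] inv_into_into])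
    then show "(f \<circ> inv_into U \<phi>) x = g (inv_into U \<phi> x)" using assms(1) by simp
  qed
qed

lemma sm_const: "sm (\<lambda>p. c)"
  by (intro smI Ck_on_const)

lemma sm_bounded_linear:
  assumes "bounded_linear L" "sm f"
  shows "sm (\<lambda>p. L (f p))"
  by (rule smI, rule Ck_on_bounded_linear[OF assms(1)]) (use smD[OF assms(2)] in \<open>simp_all add: o_def\<close>)

lemma sm_add:
  assumes "sm f" "sm g"
  shows "sm (\<lambda>p. f p + g p)"
  by (rule smI, rule Ck_on_add) (use smD[OF assms(1)] smD[OF assms(2)] in \<open>simp_all add: o_def\<close>)

lemma sm_bilinear:
  assumes "bounded_bilinear B" "sm f" "sm g"
  shows "sm (\<lambda>p. B (f p) (g p))"
  by (rule smI, rule Ck_on_bilinear[OF assms(1)])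
     (use smD[OF assms(2)] smD[OF assms(3)] in \<open>simp_all add: o_def\<close>)

lemmas sm_mult = sm_bilinear[OF bounded_bilinear_mult]
lemmas sm_scaleR = sm_bilinear[OF bounded_bilinear_scaleR]
lemmas sm_uminus = sm_bounded_linear[OF bounded_linear_minus[OF bounded_linear_ident]]
lemmas sm_nth = sm_bounded_linear[OF bounded_linear_vec_nth]

lemma sm_diff: "sm f \<Longrightarrow> sm g \<Longrightarrow> sm (\<lambda>p. f p - g p)"
  using sm_add[OF _ sm_uminus, of f g] by simp

lemmas sm_intros = sm_const sm_add sm_mult sm_scaleR sm_diff sm_uminus sm_nth

lemma chart_value:
  assumes "(U, \<phi>) \<in> Atl" "p \<in> U"
  shows "(f \<circ> inv_into U \<phi>) (\<phi> p) = f p"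
  using chart(4)[OF assms(1)] assms(2) by simp

lemma sm_chart_has_derivative:
  assumes "(U, \<phi>) \<in> Atl" "p \<in> U" "sm f"
  shows "((f \<circ> inv_into U \<phi>) has_derivative chart_derivative (U, \<phi>) f p) (at (\<phi> p))"
proof -
  have "(f \<circ> inv_into U \<phi>) differentiable (at (\<phi> p))"
    using assms by (intro Cinf_on_differentiable[of _ "\<phi> ` U"]) (auto simp: surface_smooth_def)
  then show ?thesis by (simp add: frechet_derivative_works chart_derivative_def[abs_def])
qed

lemma chart_derivative_eqI:
  assumes "((f \<circ> inv_into U \<phi>) has_derivative f') (at (\<phi> p))"
  shows "chart_derivative (U, \<phi>) f p = f'"
  using frechet_derivative_at[OF assms] by (simp add: chart_derivative_def[abs_def])

lemma sm_F: "sm F" and F_AdS: "p \<in> M \<Longrightarrow> F p \<in> AdS \<kappa>"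
  and inj_dF: "c \<in> Atl \<Longrightarrow> p \<in> fst c \<Longrightarrow> inj (chart_derivative c F p)"
  using immersion unfolding pseudo_riemannian_immersion_def by auto

lemma transition:
  assumes "(U, \<phi>) \<in> Atl" "(V, \<psi>) \<in> Atl" "p \<in> U" "p \<in> V" "sm f"
  obtains L where
    "chart_derivative (U, \<phi>) F p = (\<lambda>w. chart_derivative (V, \<psi>) F p (L w))"
    "chart_derivative (U, \<phi>) f p = (\<lambda>w. chart_derivative (V, \<psi>) f p (L w))"
proof -
  let ?t = "\<psi> \<circ> inv_into U \<phi>"
  have "openin (subtopology S U) (U \<inter> V)"
    using chart(1)[OF assms(2)] by (auto simp: openin_subtopology Int_commute)
  then have "openin (top_of_set (\<phi> ` U)) (\<phi> ` (U \<inter> V))"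
    using chart(5)[OF assms(1)] homeomorphic_imp_open_map open_map_def by blast
  then have op: "open (\<phi> ` (U \<inter> V))"
    using chart(2)[OF assms(1)] openin_open_trans by blast
  have "Cinf_on ?t (\<phi> ` (U \<inter> V))"
  proof -
    have "\<forall>(U, \<phi>)\<in>Atl. \<forall>(V, \<psi>)\<in>Atl. Cinf_on (\<psi> \<circ> inv_into U \<phi>) (\<phi> ` (U \<inter> V))"
      using smooth unfolding smooth_surface_def by (elim conjE)
    from bspec[OF bspec[OF this assms(1), simplified] assms(2)] show ?thesis by simp
  qed
  then have "?t differentiable (at (\<phi> p))"
    using assms by (auto intro: Cinf_on_differentiable)
  then obtain L where L: "(?t has_derivative L) (at (\<phi> p))"
    by (auto simp: differentiable_def)
  have tp: "?t (\<phi> p) = \<psi> p" using chart_value[OF assms(1,3)] by simp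
  have key: "chart_derivative (U, \<phi>) f p = (\<lambda>w. chart_derivative (V, \<psi>) f p (L w))"
    if "sm f" for f :: "'m \<Rightarrow> 'd::real_normed_vector"
  proof (rule chart_derivative_eqI)
    have "((f \<circ> inv_into V \<psi>) \<circ> ?t has_derivative chart_derivative (V, \<psi>) f p \<circ> L) (at (\<phi> p))"
      using sm_chart_has_derivative[OF assms(2,4) that] by (intro diff_chain_at L) (simp only: tp)
    then show "((f \<circ> inv_into U \<phi>) has_derivative (\<lambda>w. chart_derivative (V, \<psi>) f p (L w))) (at (\<phi> p))"
      unfolding o_def[of "chart_derivative (V, \<psi>) f p"]
    proof (rule has_derivative_transform_within_open[OF _ op])
      show "\<phi> p \<in> \<phi> ` (U \<inter> V)" using assms by auto
      fix x assume "x \<in> \<phi> ` (U \<inter> V)"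
      then obtain q where "x = \<phi> q" "q \<in> U" "q \<in> V" by auto
      then show "(f \<circ> inv_into V \<psi> \<circ> ?t) x = (f \<circ> inv_into U \<phi>) x"
        using chart_value[OF assms(1), of q id] chart_value[OF assms(2), of q id] by (simp add: id_def)
    qed
  qed
  show ?thesis by (rule that[of L]) (use key sm_F assms(5) in auto)
qed

lemma TM_chart:
  assumes "(U, \<phi>) \<in> Atl" "p \<in> U"
  shows "TM p = range (chart_derivative (U, \<phi>) F p)"
proof -
  have "v \<in> range (chart_derivative (U, \<phi>) F p)"
    if v: "v \<in> range (chart_derivative (V, \<psi>) F p)" and V: "(V, \<psi>) \<in> Atl" "p \<in> V"
    for v V \<psi>
  proof -
    obtain L where "chart_derivative (V, \<psi>) F p = (\<lambda>w. chart_derivative (U, \<phi>) F p (L w))"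
      using transition[OF V(1) assms(1) V(2) assms(2) sm_F] by blast
    then show ?thesis using v by auto
  qed
  then show ?thesis using assms unfolding surface_tangent_def by force
qed

text \<open>The description in \<open>surface_derivative\<close> is unambiguous: a representation of
  the same vector in another chart is carried back by \<open>transition\<close>, and injectivity of
  the differential of \<open>F\<close> leaves only \<open>w\<close>.\<close>

lemma sd_chart:
  assumes "(U, \<phi>) \<in> Atl" "p \<in> U" "sm f"
  shows "sd f p (chart_derivative (U, \<phi>) F p w) = chart_derivative (U, \<phi>) f p w"
  unfolding surface_derivative_def
proof (rule the_equality)
  show "\<exists>c\<in>Atl. \<exists>w'. p \<in> fst c \<and> chart_derivative (U, \<phi>) F p w = chart_derivative c F p w' \<and>
          chart_derivative (U, \<phi>) f p w = chart_derivative c f p w'"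
    using assms by (intro bexI[of _ "(U, \<phi>)"]) auto
next
  fix d
  assume "\<exists>c\<in>Atl. \<exists>w'. p \<in> fst c \<and> chart_derivative (U, \<phi>) F p w = chart_derivative c F p w' \<and>
            d = chart_derivative c f p w'"
  then obtain V \<psi> w' where V: "(V, \<psi>) \<in> Atl" "p \<in> V"
    and eq: "chart_derivative (U, \<phi>) F p w = chart_derivative (V, \<psi>) F p w'"
    and d: "d = chart_derivative (V, \<psi>) f p w'" by auto
  obtain L where L: "chart_derivative (V, \<psi>) F p = (\<lambda>w. chart_derivative (U, \<phi>) F p (L w))"
      "chart_derivative (V, \<psi>) f p = (\<lambda>w. chart_derivative (U, \<phi>) f p (L w))"
    using transition[OF V(1) assms(1) V(2) assms(2) assms(3)] .
  have "w = L w'" using inj_dF[OF assms(1)] assms(2) eq by (simp add: L(1) inj_eq)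
  then show "d = chart_derivative (U, \<phi>) f p w" by (simp add: d L(2))
qed

lemma TM_cases:
  assumes "p \<in> M" "v \<in> TM p"
  obtains U \<phi> w where "(U, \<phi>) \<in> Atl" "p \<in> U" "v = chart_derivative (U, \<phi>) F p w"
  using chart_exists[OF assms(1)] TM_chart assms(2) by (metis imageE)

lemma linear_chart_derivative:
  "(U, \<phi>) \<in> Atl \<Longrightarrow> p \<in> U \<Longrightarrow> sm f \<Longrightarrow> linear (chart_derivative (U, \<phi>) f p)"
  using sm_chart_has_derivative has_derivative_linear by blast

lemma subspace_TM: "p \<in> M \<Longrightarrow> subspace (TM p)"
  using chart_exists[of p] TM_chart linear_chart_derivative[OF _ _ sm_F]
  by (metis linear_subspace_image subspace_UNIV)

lemma dim_TM: "p \<in> M \<Longrightarrow> dim (TM p) = 2"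
proof -
  assume "p \<in> M"
  then obtain U \<phi> where c: "(U, \<phi>) \<in> Atl" "p \<in> U" by (rule chart_exists)
  have "inj (chart_derivative (U, \<phi>) F p)" using inj_dF[OF c(1)] c(2) by simp
  then show "dim (TM p) = 2"
    using dim_image_eq[OF linear_chart_derivative[OF c sm_F], of UNIV] TM_chart[OF c]
    by (simp add: span_UNIV)
qed

section \<open>Rules for derivatives along tangent vectors\<close>

lemma sd_const: "p \<in> M \<Longrightarrow> v \<in> TM p \<Longrightarrow> sd (\<lambda>q. k) p v = 0"
  by (erule (1) TM_cases)
     (simp add: sd_chart sm_const chart_derivative_eqI[of "\<lambda>q. k" _ _ "\<lambda>_. 0"] o_def)

lemma sd_add:
  assumes "p \<in> M" "v \<in> TM p" "sm f" "sm g"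
  shows "sd (\<lambda>q. f q + g q) p v = sd f p v + sd g p v"
proof -
  obtain U \<phi> w where c: "(U, \<phi>) \<in> Atl" "p \<in> U" "v = chart_derivative (U, \<phi>) F p w"
    using TM_cases assms(1,2) by blast
  have "chart_derivative (U, \<phi>) (\<lambda>q. f q + g q) p
      = (\<lambda>w. chart_derivative (U, \<phi>) f p w + chart_derivative (U, \<phi>) g p w)"
    using has_derivative_add[OF sm_chart_has_derivative[OF c(1,2) assms(3)]
        sm_chart_has_derivative[OF c(1,2) assms(4)]]
    by (intro chart_derivative_eqI) (simp add: o_def)
  then show ?thesis using c assms by (simp add: sd_chart sm_add)
qed

lemma sd_mult:
  assumes "p \<in> M" "v \<in> TM p" "sm f" "sm g"
  shows "sd (\<lambda>q. f q * g q) p v = f p * sd g p v + sd f p v * g p"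
proof -
  obtain U \<phi> w where c: "(U, \<phi>) \<in> Atl" "p \<in> U" "v = chart_derivative (U, \<phi>) F p w"
    using TM_cases assms(1,2) by blast
  have "chart_derivative (U, \<phi>) (\<lambda>q. f q * g q) p
      = (\<lambda>w. f p * chart_derivative (U, \<phi>) g p w + chart_derivative (U, \<phi>) f p w * g p)"
    using has_derivative_mult[OF sm_chart_has_derivative[OF c(1,2) assms(3)]
        sm_chart_has_derivative[OF c(1,2) assms(4)]]
      chart_value[OF c(1,2), of f] chart_value[OF c(1,2), of g]
    by (intro chart_derivative_eqI) (simp add: o_def)
  then show ?thesis using c assms by (simp add: sd_chart sm_mult)
qed

lemma sd_cmult: "p \<in> M \<Longrightarrow> v \<in> TM p \<Longrightarrow> sm f \<Longrightarrow> sd (\<lambda>q. k * f q) p v = k * sd f p v"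
  using sd_mult[OF _ _ sm_const, of p v f k] by (simp add: sd_const)

lemma sd_minus: "p \<in> M \<Longrightarrow> v \<in> TM p \<Longrightarrow> sm f \<Longrightarrow> sd (\<lambda>q. - f q) p v = - sd f p v"
  using sd_cmult[of p v f "-1"] by simp

lemma sd_diff:
  "p \<in> M \<Longrightarrow> v \<in> TM p \<Longrightarrow> sm f \<Longrightarrow> sm g \<Longrightarrow> sd (\<lambda>q. f q - g q) p v = sd f p v - sd g p v"
  using sd_add[OF _ _ _ sm_uminus, of p v f g] sd_minus[of p v g] by simp

lemma sd_linear_F:
  fixes L :: "real^4 \<Rightarrow> real"
  assumes "p \<in> M" "v \<in> TM p" "linear L"
  shows "sd (\<lambda>q. L (F q)) p v = L v"
proof -
  have L: "bounded_linear L" using assms(3) by (simp add: linear_conv_bounded_linear)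
  obtain U \<phi> w where c: "(U, \<phi>) \<in> Atl" "p \<in> U" "v = chart_derivative (U, \<phi>) F p w"
    using TM_cases assms(1,2) by blast
  have "chart_derivative (U, \<phi>) (\<lambda>q. L (F q)) p = (\<lambda>w. L (chart_derivative (U, \<phi>) F p w))"
    using bounded_linear.has_derivative[OF L sm_chart_has_derivative[OF c(1,2) sm_F]]
    by (intro chart_derivative_eqI) (simp add: o_def)
  then show ?thesis using c by (simp add: sd_chart sm_bounded_linear[OF L] sm_F)
qed

lemma sd_linear:
  assumes "p \<in> M" "u \<in> TM p" "v \<in> TM p" "sm f"
  shows "sd f p (a *\<^sub>R u + b *\<^sub>R v) = a * sd f p u + b * sd f p v"
proof -
  obtain U \<phi> w where c: "(U, \<phi>) \<in> Atl" "p \<in> U" "v = chart_derivative (U, \<phi>) F p w"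
    using TM_cases assms by blast
  obtain w' where w': "u = chart_derivative (U, \<phi>) F p w'"
    using TM_chart[OF c(1,2)] assms(2) by auto
  have l: "chart_derivative (U, \<phi>) h p (a *\<^sub>R w' + b *\<^sub>R w)
     = a *\<^sub>R chart_derivative (U, \<phi>) h p w' + b *\<^sub>R chart_derivative (U, \<phi>) h p w"
    if "sm h" for h :: "'m \<Rightarrow> 'd::real_normed_vector"
    using linear_chart_derivative[OF c(1,2) that] by (simp add: linear_add linear_scale)
  show ?thesis
    using sd_chart[OF c(1,2) assms(4), of "a *\<^sub>R w' + b *\<^sub>R w"] c assms
    by (simp add: l[OF sm_F] l[OF assms(4)] w' sd_chart)
qed

lemma sd_cong:
  assumes "\<And>q. q \<in> M \<Longrightarrow> f q = g q" "sm f" "p \<in> M" "v \<in> TM p"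
  shows "sd f p v = sd g p v"
proof -
  obtain U \<phi> w where c: "(U, \<phi>) \<in> Atl" "p \<in> U" "v = chart_derivative (U, \<phi>) F p w"
    using TM_cases assms(3,4) by blast
  have g: "sm g" by (rule sm_cong[OF assms(1,2)])
  have "chart_derivative (U, \<phi>) g p = chart_derivative (U, \<phi>) f p"
  proof (rule chart_derivative_eqI, rule has_derivative_transform_within_open
      [OF sm_chart_has_derivative[OF c(1,2) assms(2)] chart(2)[OF c(1)]])
    fix x assume "x \<in> \<phi> ` U"
    then have "inv_into U \<phi> x \<in> M" by (rule subsetD[OF chart(3)[OF c(1)] inv_into_into])
    then show "(f \<circ> inv_into U \<phi>) x = (g \<circ> inv_into U \<phi>) x" using assms(1) by simp
  qed (use c in auto)
  then show ?thesis using c assms g by (simp add: sd_chart)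
qed

lemma geometry_simps [simp]:
  "pts G = M" "fns G = {f. sm f}" "dif G = sd" "met G = (\<lambda>p. g_tau \<kappa> \<tau> (F p))"
  "Y \<in> flds G \<longleftrightarrow> sm Y \<and> (\<forall>p\<in>M. Y p \<in> TM p)"
  by (simp_all add: surface_geometry_def)

lemma sm_linear:
  fixes L :: "real^4 \<Rightarrow> 'b::real_normed_vector"
  shows "linear L \<Longrightarrow> sm f \<Longrightarrow> sm (\<lambda>p. L (f p))"
  by (simp add: sm_bounded_linear linear_conv_bounded_linear)

lemmas sm_frame = sm_linear[OF linear_frame(1)] sm_linear[OF linear_frame(2)]
  sm_linear[OF linear_frame(3)]

lemma sm_g_tau:
  assumes "sm V" "sm W"
  shows "sm (\<lambda>p. g_tau \<kappa> \<tau> (F p) (V p) (W p))"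
proof -
  have "X1 \<kappa> q = \<tau> *\<^sub>R E1 \<kappa> \<tau> q" for q using tau_pos by (simp add: E1_def)
  then show ?thesis
    unfolding g_tau_def g0_def by (auto intro!: sm_intros sm_frame sm_F assms)
qed

text \<open>Differentiate the identity \<open>g0 (F q) (F q) = - 4 / \<kappa>\<close> along
  \<open>v\<close>.\<close>

lemma TM_AdS:
  assumes "p \<in> M" "v \<in> TM p"
  shows "v \<in> AdS_tangent (F p)"
proof -
  have i: "sm (\<lambda>q. F q $ i)" "sd (\<lambda>q. F q $ i) p v = v $ i" for i
    using assms by (simp_all add: sm_nth sm_F sd_linear_F[OF _ _ linear_nth])
  have "sd (\<lambda>q. g0 (F q) (F q)) p v = sd (\<lambda>q. - 4 / \<kappa>) p v"
    using F_AdS by (intro sd_cong[symmetric] assms sm_const) (simp add: AdS_def)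
  also have "\<dots> = 0" using assms by (rule sd_const)
  finally have "2 * g0 (F p) v = 0"
    using assms unfolding g0_def by (simp add: sd_add sd_diff sd_mult i sm_intros algebra_simps)
  then show ?thesis by (simp add: AdS_tangent_def)
qed

text \<open>Tangent vectors are identified with their images under the differential of
  \<open>F\<close>, so the derivative of the i-th coordinate of \<open>F\<close> along a field is
  the i-th entry of that field. The bracket axiom for these functions gives the entries of
  \<open>W\<close>.\<close>

lemma lie_bracket_nth:
  assumes "is_lie_bracket G X Y W" "X \<in> flds G" "Y \<in> flds G" "p \<in> M"
  shows "W p $ i = sd (\<lambda>q. Y q $ i) p (X p) - sd (\<lambda>q. X q $ i) p (Y p)"
proof -
  have F: "sd (\<lambda>q. F q $ i) q (Z q) = Z q $ i" if "Z \<in> flds G" "q \<in> M" for Z q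
    using that by (intro sd_linear_F linear_nth) auto
  have "W \<in> flds G" and "sd (\<lambda>q. F q $ i) p (W p) =
     sd (\<lambda>q. sd (\<lambda>q. F q $ i) q (Y q)) p (X p) - sd (\<lambda>q. sd (\<lambda>q. F q $ i) q (X q)) p (Y p)"
    using assms(1,4) by (simp_all add: is_lie_bracket_def sm_nth sm_F)
  moreover have "sd (\<lambda>q. sd (\<lambda>q. F q $ i) q (Z q)) p v = sd (\<lambda>q. Z q $ i) p v"
    if "Z \<in> flds G" "v \<in> TM p" for Z v
    using that assms(4) F[OF that(1)] by (intro sd_cong[symmetric] sm_nth) auto
  ultimately show ?thesis using assms(2-4) F by simp
qed

lemma lie_bracket_unique:
  assumes "is_lie_bracket G X Y W" "is_lie_bracket G X Y W'" "X \<in> flds G" "Y \<in> flds G" "p \<in> M"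
  shows "W p = W' p"
  using lie_bracket_nth[OF assms(1) assms(3-5)] lie_bracket_nth[OF assms(2) assms(3-5)]
  by (simp add: vec_eq_iff)

text \<open>Leibniz rule plus the structure equations [E2,E3] = sqrt \<kappa> \<tau> E1, [E3,E1] = -
  (sqrt \<kappa> / \<tau>) E2, [E1,E2] = - (sqrt \<kappa> / \<tau>) E3. Single frame fields may fail
  to be tangent to the surface, so the formula is obtained by differentiating coordinates along
  \<open>F\<close>.\<close>

lemma lie_bracket_frame:
  assumes "is_lie_bracket G X Y W" "X \<in> flds G" "Y \<in> flds G" "p \<in> M"
    and sm: "sm a1" "sm a2" "sm a3" "sm b1" "sm b2" "sm b3"
    and X: "\<And>q. q \<in> M \<Longrightarrow> X q = a1 q *\<^sub>R E1 \<kappa> \<tau> (F q) + a2 q *\<^sub>R E2 \<kappa> (F q) + a3 q *\<^sub>R E3 \<kappa> (F q)"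
    and Y: "\<And>q. q \<in> M \<Longrightarrow> Y q = b1 q *\<^sub>R E1 \<kappa> \<tau> (F q) + b2 q *\<^sub>R E2 \<kappa> (F q) + b3 q *\<^sub>R E3 \<kappa> (F q)"
  shows "W p =
    (sd b1 p (X p) - sd a1 p (Y p) + sqrt \<kappa> * \<tau> * (a2 p * b3 p - a3 p * b2 p)) *\<^sub>R E1 \<kappa> \<tau> (F p) +
    (sd b2 p (X p) - sd a2 p (Y p) - sqrt \<kappa> / \<tau> * (a3 p * b1 p - a1 p * b3 p)) *\<^sub>R E2 \<kappa> (F p) +
    (sd b3 p (X p) - sd a3 p (Y p) - sqrt \<kappa> / \<tau> * (a1 p * b2 p - a2 p * b1 p)) *\<^sub>R E3 \<kappa> (F p)"
proof -
  have fr: "sd (\<lambda>q. E1 \<kappa> \<tau> (F q) $ i) p v = E1 \<kappa> \<tau> v $ i" "sd (\<lambda>q. E2 \<kappa> (F q) $ i) p v = E2 \<kappa> v $ i"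
    "sd (\<lambda>q. E3 \<kappa> (F q) $ i) p v = E3 \<kappa> v $ i" if "v \<in> TM p" for v i
    using linear_compose[OF linear_frame(1)[of \<kappa> \<tau>] linear_nth[of i]]
      linear_compose[OF linear_frame(2)[of \<kappa>] linear_nth[of i]]
      linear_compose[OF linear_frame(3)[of \<kappa>] linear_nth[of i]] that assms(4)
    by (simp_all add: sd_linear_F[where L = "\<lambda>x. E1 \<kappa> \<tau> x $ i"] o_def
       sd_linear_F[where L = "\<lambda>x. E2 \<kappa> x $ i"] sd_linear_F[where L = "\<lambda>x. E3 \<kappa> x $ i"])
  have deriv: "sd (\<lambda>q. Z q $ i) p v =
      sd c1 p v * E1 \<kappa> \<tau> (F p) $ i + sd c2 p v * E2 \<kappa> (F p) $ i + sd c3 p v * E3 \<kappa> (F p) $ i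
      + c1 p * E1 \<kappa> \<tau> v $ i + c2 p * E2 \<kappa> v $ i + c3 p * E3 \<kappa> v $ i"
    if "\<And>q. q \<in> M \<Longrightarrow> Z q = c1 q *\<^sub>R E1 \<kappa> \<tau> (F q) + c2 q *\<^sub>R E2 \<kappa> (F q) + c3 q *\<^sub>R E3 \<kappa> (F q)"
      "sm c1" "sm c2" "sm c3" "v \<in> TM p" for Z c1 c2 c3 v i
  proof -
    have "sd (\<lambda>q. Z q $ i) p v = sd (\<lambda>q. c1 q * E1 \<kappa> \<tau> (F q) $ i + c2 q * E2 \<kappa> (F q) $ i
       + c3 q * E3 \<kappa> (F q) $ i) p v"
      using that assms(4) by (intro sd_cong[symmetric] sm_intros sm_frame sm_F) auto
    then show ?thesis
      using that(2-5) assms(4)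
      by (simp add: sd_add sd_mult fr sm_intros sm_frame sm_F algebra_simps)
  qed
  have XY: "X p \<in> TM p" "Y p \<in> TM p" using assms(2-4) by auto
  have W: "W p $ i =
      (sd b1 p (X p) * E1 \<kappa> \<tau> (F p) $ i + sd b2 p (X p) * E2 \<kappa> (F p) $ i + sd b3 p (X p) * E3 \<kappa> (F p) $ i
      + b1 p * E1 \<kappa> \<tau> (X p) $ i + b2 p * E2 \<kappa> (X p) $ i + b3 p * E3 \<kappa> (X p) $ i) -
      (sd a1 p (Y p) * E1 \<kappa> \<tau> (F p) $ i + sd a2 p (Y p) * E2 \<kappa> (F p) $ i + sd a3 p (Y p) * E3 \<kappa> (F p) $ i
      + a1 p * E1 \<kappa> \<tau> (Y p) $ i + a2 p * E2 \<kappa> (Y p) $ i + a3 p * E3 \<kappa> (Y p) $ i)" for i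
    using lie_bracket_nth[OF assms(1-4), of i] deriv[OF Y sm(4-6) XY(1), of i]
      deriv[OF X sm(1-3) XY(2), of i] by linarith
  define k l where kl: "k = sqrt \<kappa> / (2 * \<tau>)" "l = sqrt \<kappa> * \<tau> / 2"
  have E: "sqrt \<kappa> / \<tau> = 2 * k" "sqrt \<kappa> * \<tau> = 2 * l" by (simp_all add: kl)
  note ap = arg_cong[OF X[OF assms(4)], of "E1 \<kappa> \<tau>"] arg_cong[OF X[OF assms(4)], of "E2 \<kappa>"]
    arg_cong[OF X[OF assms(4)], of "E3 \<kappa>"] arg_cong[OF Y[OF assms(4)], of "E1 \<kappa> \<tau>"]
    arg_cong[OF Y[OF assms(4)], of "E2 \<kappa>"] arg_cong[OF Y[OF assms(4)], of "E3 \<kappa>"]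
  note compose = frame_compose[OF kappa_pos tau_pos, folded kl]
  show ?thesis
    unfolding vec_eq_iff W E
    by (simp only: ap frame_linear compose vector_add_component vector_scaleR_component)
       (simp add: algebra_simps)
qed

end

text \<open>A field that vanishes on the surface equals its multiple by the indicator function of the
  complement of the surface, which is smooth; so the axioms of a connection do not see the values
  of a field off the surface.\<close>

locale surface_connection = immersed_surface \<kappa> \<tau> S Atl F
  for \<kappa> \<tau> and S :: "'m topology" and Atl and F +
  fixes D :: "('m \<Rightarrow> real^4) \<Rightarrow> ('m \<Rightarrow> real^4) \<Rightarrow> 'm \<Rightarrow> real^4"
  assumes levi_civita: "levi_civita (surface_geometry \<kappa> \<tau> S Atl F) D"
begin

lemma affine: "affine_connection G D" using levi_civita by (simp add: levi_civita_def)

lemma D_flds: "X \<in> flds G \<Longrightarrow> Y \<in> flds G \<Longrightarrow> D X Y \<in> flds G"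
  and D_add1: "X \<in> flds G \<Longrightarrow> X' \<in> flds G \<Longrightarrow> Y \<in> flds G \<Longrightarrow> p \<in> M \<Longrightarrow>
    D (\<lambda>q. X q + X' q) Y p = D X Y p + D X' Y p"
  and D_scale1: "sm f \<Longrightarrow> X \<in> flds G \<Longrightarrow> Y \<in> flds G \<Longrightarrow> p \<in> M \<Longrightarrow>
    D (\<lambda>q. f q *\<^sub>R X q) Y p = f p *\<^sub>R D X Y p"
  and D_add2: "X \<in> flds G \<Longrightarrow> Y \<in> flds G \<Longrightarrow> Y' \<in> flds G \<Longrightarrow> p \<in> M \<Longrightarrow>
    D X (\<lambda>q. Y q + Y' q) p = D X Y p + D X Y' p"
  and D_scale2: "sm f \<Longrightarrow> X \<in> flds G \<Longrightarrow> Y \<in> flds G \<Longrightarrow> p \<in> M \<Longrightarrow>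
    D X (\<lambda>q. f q *\<^sub>R Y q) p = sd f p (X p) *\<^sub>R Y p + f p *\<^sub>R D X Y p"
  using affine unfolding affine_connection_def geometry_simps(1-4) mem_Collect_eq by blast+

lemma D_torsion: "X \<in> flds G \<Longrightarrow> Y \<in> flds G \<Longrightarrow> is_lie_bracket G X Y (\<lambda>p. D X Y p - D Y X p)"
  and D_metric: "X \<in> flds G \<Longrightarrow> Y \<in> flds G \<Longrightarrow> Z \<in> flds G \<Longrightarrow> p \<in> M \<Longrightarrow>
     sd (\<lambda>q. g_tau \<kappa> \<tau> (F q) (Y q) (Z q)) p (X p) =
       g_tau \<kappa> \<tau> (F p) (D X Y p) (Z p) + g_tau \<kappa> \<tau> (F p) (Y p) (D X Z p)"
  using levi_civita unfolding levi_civita_def geometry_simps(1-4) by blast+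

lemma flds_add: "X \<in> flds G \<Longrightarrow> Y \<in> flds G \<Longrightarrow> (\<lambda>q. X q + Y q) \<in> flds G"
  and flds_diff: "X \<in> flds G \<Longrightarrow> Y \<in> flds G \<Longrightarrow> (\<lambda>q. X q - Y q) \<in> flds G"
  and flds_scale: "sm f \<Longrightarrow> X \<in> flds G \<Longrightarrow> (\<lambda>q. f q *\<^sub>R X q) \<in> flds G"
  using subspace_add[OF subspace_TM] subspace_diff[OF subspace_TM] subspace_scale[OF subspace_TM]
  by (auto intro: sm_intros)

lemma sm_off: "sm (\<lambda>q. if q \<in> M then 0 else 1 :: real)"
  by (rule sm_cong[OF _ sm_const[of 0]]) simp

lemma sd_off: "p \<in> M \<Longrightarrow> v \<in> TM p \<Longrightarrow> sd (\<lambda>q. if q \<in> M then 0 else 1) p v = 0"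
  using sd_cong[OF _ sm_const[of 0], of "\<lambda>q. if q \<in> M then 0 else 1" p v] by (simp add: sd_const)

lemma D_cong:
  assumes "X \<in> flds G" "X' \<in> flds G" "Y \<in> flds G" "Y' \<in> flds G" "p \<in> M"
    "\<And>q. q \<in> M \<Longrightarrow> X q = X' q" "\<And>q. q \<in> M \<Longrightarrow> Y q = Y' q"
  shows "D X Y p = D X' Y' p"
proof -
  define f :: "'m \<Rightarrow> real" where "f = (\<lambda>q. if q \<in> M then 0 else 1)"
  have XY: "X = (\<lambda>q. X' q + f q *\<^sub>R (X q - X' q))" "Y = (\<lambda>q. Y' q + f q *\<^sub>R (Y q - Y' q))"
    using assms(6,7) by (auto simp: f_def)
  have f: "sm f" "f p = 0" "sd f p (X' p) = 0"
    using sm_off sd_off assms(2,5) by (auto simp: f_def)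
  have "D X Y p = D (\<lambda>q. X' q + f q *\<^sub>R (X q - X' q)) Y p"
    by (rule arg_cong[OF XY(1), of "\<lambda>X. D X Y p"])
  also have "\<dots> = D X' Y p + D (\<lambda>q. f q *\<^sub>R (X q - X' q)) Y p"
    by (intro D_add1 assms flds_scale flds_diff f)
  also have "D (\<lambda>q. f q *\<^sub>R (X q - X' q)) Y p = 0"
    using D_scale1[OF f(1) flds_diff[OF assms(1,2)] assms(3,5)] f by simp
  finally have 1: "D X Y p = D X' Y p" by simp
  have "D X' Y p = D X' (\<lambda>q. Y' q + f q *\<^sub>R (Y q - Y' q)) p"
    by (rule arg_cong[OF XY(2), of "\<lambda>Y. D X' Y p"])
  also have "\<dots> = D X' Y' p + D X' (\<lambda>q. f q *\<^sub>R (Y q - Y' q)) p"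
    by (intro D_add2 assms flds_scale flds_diff f)
  also have "D X' (\<lambda>q. f q *\<^sub>R (Y q - Y' q)) p = 0"
    using D_scale2[OF f(1) assms(2) flds_diff[OF assms(3,4)] assms(5)] f by simp
  finally show ?thesis using 1 by simp
qed

end

section \<open>The adapted frame of a helix surface\<close>

locale helix = surface_connection \<kappa> \<tau> S Atl F D
  for \<kappa> \<tau> and S :: "'m topology" and Atl and F and D +
  fixes lam \<nu> :: real and N :: "'m \<Rightarrow> real^4"
  assumes helix: "helix_surface \<kappa> \<tau> S Atl F lam N \<nu>" and nu: "\<nu> \<noteq> 0"
begin

abbreviation "g p \<equiv> g_tau \<kappa> \<tau> (F p)"
abbreviation "e1 p \<equiv> E1 \<kappa> \<tau> (F p)"
abbreviation "e2 p \<equiv> E2 \<kappa> (F p)"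
abbreviation "e3 p \<equiv> E3 \<kappa> (F p)"
abbreviation "T \<equiv> tangent_part \<kappa> \<tau> F lam N"
abbreviation "JT \<equiv> J_rot \<kappa> \<tau> F N T"

definition "n2 p = g p (N p) (e2 p)"
definition "n3 p = g p (N p) (e3 p)"
text \<open>The squared length of the part of \<open>N\<close> orthogonal to \<open>E1\<close>: the
  component along the timelike \<open>E1\<close> contributes - \<nu>^2 to g(N,N) =
  \<open>lam\<close>.\<close>

definition "r = lam + \<nu>\<^sup>2"
text \<open>\<open>\<alpha>\<close> and \<open>\<beta>\<close> are, up to sign, the structure
  constants of the frame.\<close>

definition "\<alpha> = sqrt \<kappa> / \<tau>"
definition "\<beta> = sqrt \<kappa> * \<tau>"

lemma beta_pos: "\<beta> > 0" using kappa_pos tau_pos by (simp add: \<beta>_def)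

lemma alpha_beta: "\<alpha> * \<beta> = \<kappa>" "\<beta> * \<beta> = \<kappa> * \<tau>\<^sup>2"
  using kappa_pos tau_pos by (simp_all add: \<alpha>_def \<beta>_def power2_eq_square)

lemma N: "sm N" "p \<in> M \<Longrightarrow> N p \<in> AdS_tangent (F p)" "p \<in> M \<Longrightarrow> g p (N p) (N p) = lam"
    "p \<in> M \<Longrightarrow> v \<in> TM p \<Longrightarrow> g p (N p) v = 0"
  and lam: "lam * lam = 1"
  and angle: "p \<in> M \<Longrightarrow> angle_function \<kappa> \<tau> F lam N p = \<nu>"
  using helix unfolding helix_surface_def unit_normal_def fields_along_def by auto

lemma lam_cancel [simp]: "lam * (lam * x) = x"
  by (metis lam mult.assoc mult_1)

lemma lam_nonzero [simp]: "lam \<noteq> 0"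
  using lam by auto

declare lam [simp]

lemma N_e1: "p \<in> M \<Longrightarrow> g p (N p) (e1 p) = lam * \<nu>"
  using angle[of p] by (metis angle_function_def lam_cancel)

lemmas orthonormal = frame_orthonormal[OF kappa_pos tau_pos F_AdS]

section \<open>Frame components of the normal and of the adapted tangent frame\<close>

lemma N_frame: "p \<in> M \<Longrightarrow> N p = (- lam * \<nu>) *\<^sub>R e1 p + n2 p *\<^sub>R e2 p + n3 p *\<^sub>R e3 p"
  using frame_expansion[OF kappa_pos tau_pos F_AdS N(2)] by (simp add: N_e1 n2_def n3_def)

lemma n_norm: "p \<in> M \<Longrightarrow> n2 p * n2 p + n3 p * n3 p = r"
proof -
  assume p: "p \<in> M"
  have "lam = g p (N p) ((- lam * \<nu>) *\<^sub>R e1 p + n2 p *\<^sub>R e2 p + n3 p *\<^sub>R e3 p)"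
    using N(3)[OF p] N_frame[OF p] by simp
  also have "\<dots> = - (lam * (lam * (\<nu> * \<nu>))) + n2 p * n2 p + n3 p * n3 p"
    using p by (simp only: g_tau_linear N_e1 flip: n2_def n3_def) (simp add: mult.left_commute)
  finally have "lam = - (\<nu> * \<nu>) + n2 p * n2 p + n3 p * n3 p" by (simp only: lam_cancel)
  then show ?thesis unfolding r_def power2_eq_square by linarith
qed

lemma T_frame:
  assumes "p \<in> M"
  shows "T p = (lam * r) *\<^sub>R e1 p + (- \<nu> * n2 p) *\<^sub>R e2 p + (- \<nu> * n3 p) *\<^sub>R e3 p"
proof -
  have "T p = e1 p - \<nu> *\<^sub>R ((- lam * \<nu>) *\<^sub>R e1 p + n2 p *\<^sub>R e2 p + n3 p *\<^sub>R e3 p)"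
    using N_frame[OF assms] by (simp add: tangent_part_def angle[OF assms])
  moreover have "lam * r = 1 + lam * (\<nu> * \<nu>)"
    using lam by (simp add: r_def power2_eq_square algebra_simps)
  ultimately show ?thesis by (simp add: algebra_simps)
qed

lemma JT_frame:
  assumes "p \<in> M"
  shows "JT p = 0 *\<^sub>R e1 p + n3 p *\<^sub>R e2 p + (- n2 p) *\<^sub>R e3 p"
proof -
  note o = orthonormal[OF assms]
  have N: "g p (N p) (e1 p) = lam * \<nu>" "g p (N p) (e2 p) = n2 p" "g p (N p) (e3 p) = n3 p"
    using assms by (simp_all add: N_e1 n2_def n3_def)
  have T: "g p (T p) (e1 p) = - (lam * r)" "g p (T p) (e2 p) = - \<nu> * n2 p"
    "g p (T p) (e3 p) = - \<nu> * n3 p"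
    by (simp_all add: T_frame[OF assms] g_tau_linear o)
  have "lam * r - lam * \<nu> * \<nu> = 1"
    using lam by (simp add: r_def power2_eq_square algebra_simps)
  then have "- (lam * \<nu>) * (- \<nu> * n2 p) - n2 p * (lam * r) = - n2 p"
    "n3 p * (lam * r) - (- (lam * \<nu>)) * (- \<nu> * n3 p) = n3 p" by algebra+
  then show ?thesis
    unfolding J_rot_def wedge_tau_def Let_def N T by simp
qed

lemma sm_n: "sm n2" "sm n3"
  unfolding n2_def[abs_def] n3_def[abs_def] by (intro sm_g_tau N sm_frame sm_F)+

lemma g_TJT:
  assumes "p \<in> M"
  shows "g p (T p) (T p) = - (lam * r)" "g p (JT p) (JT p) = r" "g p (T p) (JT p) = 0"
    "g p (JT p) (T p) = 0"
proof -
  note o = orthonormal[OF assms]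
  have "lam * r * (lam * r) = r * r" using lam by algebra
  moreover have "\<nu> * \<nu> * r - r * r = - lam * r"
    by (simp add: r_def power2_eq_square algebra_simps)
  ultimately have "- (lam * r) * (lam * r) + (\<nu> * n2 p) * (\<nu> * n2 p) + (\<nu> * n3 p) * (\<nu> * n3 p) = - (lam * r)"
    using n_norm[OF assms] by algebra
  then show "g p (T p) (T p) = - (lam * r)"
    by (simp add: T_frame[OF assms] g_tau_linear o)
  show "g p (JT p) (JT p) = r" using n_norm[OF assms]
    by (simp add: JT_frame[OF assms] g_tau_linear o algebra_simps)
  show "g p (T p) (JT p) = 0" "g p (JT p) (T p) = 0"
    by (simp_all add: T_frame[OF assms] JT_frame[OF assms] g_tau_linear o)
qed

text \<open>Makes tangency a matter of orthogonality to \<open>N\<close>. One inclusion is clear and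
  the dimensions agree.\<close>

lemma TM_eq:
  assumes p: "p \<in> M"
  shows "TM p = {v \<in> AdS_tangent (F p). g p (N p) v = 0}" (is "_ = ?V")
proof (rule subspace_dim_equal[OF subspace_TM[OF p]])
  have "subspace {v. g p (N p) v = 0}"
    by (auto simp: subspace_def g_tau_linear)
  then show V: "subspace ?V"
    using subspace_inter[OF subspace_AdS_tangent[of "F p"], of "{v. g p (N p) v = 0}"]
    by (simp add: Int_def)
  show "TM p \<subseteq> ?V" using TM_AdS[OF p] N(4)[OF p] by auto
  \<comment> \<open>\<open>N\<close> is not null, so its orthogonal complement is a proper subspace
    of a space of dimension at most 3.\<close>
  have "N p \<notin> ?V" using N(3)[OF p] lam by auto
  then have "?V \<subset> AdS_tangent (F p)" using N(2)[OF p] by auto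
  then have "dim ?V < dim (AdS_tangent (F p))"
    using V subspace_AdS_tangent by (intro dim_psubset) (simp add: span_eq_iff[THEN iffD2])
  also have "AdS_tangent (F p) \<subseteq> span {e1 p, e2 p, e3 p}"
    using frame_expansion[OF kappa_pos tau_pos F_AdS[OF p]]
    by (metis (no_types, lifting) insert_iff span_add span_base span_scale subsetI)
  then have "dim (AdS_tangent (F p)) \<le> card {e1 p, e2 p, e3 p}"
    by (intro dim_le_card) auto
  also have "\<dots> \<le> 3" by (simp add: card_insert_if)
  finally show "dim ?V \<le> dim (TM p)" using dim_TM[OF p] by simp
qed

lemma TJT_flds: "T \<in> flds G" "JT \<in> flds G"
proof -
  have smT: "sm T"
    by (rule sm_cong[of "\<lambda>p. e1 p - \<nu> *\<^sub>R N p"])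
       (auto simp: tangent_part_def angle intro!: sm_intros sm_frame sm_F N)
  have smJ: "sm JT"
    by (rule sm_cong[of "\<lambda>p. 0 *\<^sub>R e1 p + n3 p *\<^sub>R e2 p + (- n2 p) *\<^sub>R e3 p"])
       (auto simp: JT_frame intro!: sm_intros sm_frame sm_F sm_n)
  have tan: "T p \<in> TM p" "JT p \<in> TM p" if p: "p \<in> M" for p
  proof -
    note s = subspace_AdS_tangent[of "F p"]
    note o = orthonormal[OF p]
    have "T p \<in> AdS_tangent (F p)" "JT p \<in> AdS_tangent (F p)"
      unfolding T_frame[OF p] JT_frame[OF p]
      by (intro subspace_add[OF s] subspace_scale[OF s] frame_tangent)+
    moreover have "g p (N p) (JT p) = 0"
      by (simp add: JT_frame[OF p] N_frame[OF p] g_tau_linear o)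
    moreover have "\<nu> * (n2 p * n2 p + n3 p * n3 p) = \<nu> * r" using n_norm[OF p] by simp
    then have "g p (N p) (T p) = 0"
      by (simp add: T_frame[OF p] N_frame[OF p] g_tau_linear o algebra_simps)
    ultimately show "T p \<in> TM p" "JT p \<in> TM p" by (simp_all add: TM_eq[OF p])
  qed
  show "T \<in> flds G" "JT \<in> flds G" using smT smJ tan by auto
qed

lemma TJT_TM: "p \<in> M \<Longrightarrow> T p \<in> TM p" "p \<in> M \<Longrightarrow> JT p \<in> TM p"
  using TJT_flds by auto

text \<open>If \<open>r = 0\<close>, then \<open>E\<^sub>2\<close> and \<open>E\<^sub>3\<close> are tangent to the surface, but their bracket is not.\<close>

lemma r_nonzero:
  assumes "p \<in> M"
  shows "r \<noteq> 0"
proof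
  assume "r = 0"
  then have n: "n2 q = 0" "n3 q = 0" if "q \<in> M" for q
    using n_norm[OF that] by (simp_all add: sum_squares_eq_zero_iff)
  have XY: "(\<lambda>q. e2 q) \<in> flds G" "(\<lambda>q. e3 q) \<in> flds G"
    using n unfolding n2_def n3_def by (auto simp: TM_eq frame_tangent intro!: sm_frame sm_F)
  define W where "W = (\<lambda>q. D (\<lambda>q. e2 q) (\<lambda>q. e3 q) q - D (\<lambda>q. e3 q) (\<lambda>q. e2 q) q)"
  have "is_lie_bracket G (\<lambda>q. e2 q) (\<lambda>q. e3 q) W"
    unfolding W_def by (rule D_torsion[OF XY])
  from lie_bracket_frame[OF this XY assms sm_const[of 0] sm_const[of 1] sm_const[of 0]
      sm_const[of 0] sm_const[of 0] sm_const[of 1]]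
  have "W p = \<beta> *\<^sub>R e1 p"
    using XY assms by (simp add: sd_const \<beta>_def)
  moreover have "W \<in> flds G" unfolding W_def by (intro flds_diff D_flds XY)
  then have "g p (N p) (W p) = 0" using assms by (auto intro: N(4))
  ultimately show False
    using beta_pos nu lam by (simp add: g_tau_linear N_e1[OF assms])
qed

text \<open>The coefficients divide by the squared lengths of the orthogonal vectors
  \<open>T\<close> and \<open>JT\<close>; the first is \<open>- lam * r\<close>, whose reciprocal is
  \<open>- lam / r\<close>.\<close>

lemma TM_expansion:
  assumes p: "p \<in> M" and v: "v \<in> TM p"
  shows "v = (- lam * g p v (T p) / r) *\<^sub>R T p + (g p v (JT p) / r) *\<^sub>R JT p"
proof -
  note o = orthonormal[OF p]
  note r = r_nonzero[OF p]
  define v1 v2 v3 where v: "v1 = - g p v (e1 p)" "v2 = g p v (e2 p)" "v3 = g p v (e3 p)"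
  have fr: "v = v1 *\<^sub>R e1 p + v2 *\<^sub>R e2 p + v3 *\<^sub>R e3 p"
    unfolding v by (rule frame_expansion[OF kappa_pos tau_pos F_AdS[OF p] TM_AdS[OF p assms(2)]])
  have gT: "g p v (T p) = - v1 * (lam * r) - \<nu> * (n2 p * v2 + n3 p * v3)"
    by (simp add: fr T_frame[OF p] g_tau_linear o algebra_simps)
  have gJ: "g p v (JT p) = v2 * n3 p - v3 * n2 p"
    by (simp add: fr JT_frame[OF p] g_tau_linear o algebra_simps)
  have "g p (N p) v = 0" using N(4)[OF p assms(2)] .
  then have c: "lam * \<nu> * v1 + n2 p * v2 + n3 p * v3 = 0"
    by (simp add: fr N_frame[OF p] g_tau_linear o algebra_simps)
  \<comment> \<open>\<open>T\<close> differs from \<open>e1\<close> by a multiple of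
    \<open>N\<close>, so pairing with the tangent vector \<open>v\<close> gives just - v1; the two
    factors \<open>lam\<close> cancel.\<close>
  then have gT': "g p v (T p) = - lam * v1 * lam"
    unfolding gT r_def using lam by algebra
  define a b where ab: "a = - lam * g p v (T p)" "b = g p v (JT p)"
  \<comment> \<open>Everything is multiplied by \<open>r\<close> to keep the identities polynomial;
    the division follows at the end.\<close>
  have rv: "r * v1 = a * (lam * r)" "r * v2 = a * (- \<nu> * n2 p) + b * n3 p"
    "r * v3 = a * (- \<nu> * n3 p) + b * (- n2 p)"
    unfolding ab gT' gJ using lam c n_norm[OF p] by algebra+
  have "r *\<^sub>R v = (r * v1) *\<^sub>R e1 p + (r * v2) *\<^sub>R e2 p + (r * v3) *\<^sub>R e3 p"
    using arg_cong[OF fr, of "\<lambda>x. r *\<^sub>R x"] by (simp add: scaleR_add_right)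
  then have "r *\<^sub>R v = a *\<^sub>R T p + b *\<^sub>R JT p"
    unfolding T_frame[OF p] JT_frame[OF p] rv by (simp add: algebra_simps)
  then have "(1 / r) *\<^sub>R (r *\<^sub>R v) = (a / r) *\<^sub>R T p + (b / r) *\<^sub>R JT p"
    by (simp add: scaleR_add_right)
  then show ?thesis using r by (simp add: ab)
qed

lemma TJT_eqI:
  assumes "p \<in> M" "a *\<^sub>R T p + b *\<^sub>R JT p = a' *\<^sub>R T p + b' *\<^sub>R JT p"
  shows "a = a'" "b = b'"
proof -
  have "g p (a *\<^sub>R T p + b *\<^sub>R JT p) v = g p (a' *\<^sub>R T p + b' *\<^sub>R JT p) v" for v
    using assms(2) by simp
  from this[of "T p"] this[of "JT p"] show "a = a'" "b = b'"
    using lam r_nonzero[OF assms(1)] by (auto simp: g_tau_linear g_TJT[OF assms(1)])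
qed

lemma TJT_basis:
  assumes p: "p \<in> M"
  shows "T p \<noteq> JT p" "independent {T p, JT p}" "span {T p, JT p} = TM p"
proof -
  show ne: "T p \<noteq> JT p" using TJT_eqI(1)[OF p, of 1 0 0 1] by auto
  show "independent {T p, JT p}"
    unfolding independent_explicit
  proof (intro conjI allI impI ballI)
    fix u v assume u: "(\<Sum>v\<in>{T p, JT p}. u v *\<^sub>R v) = 0" and v: "v \<in> {T p, JT p}"
    then have "u (T p) *\<^sub>R T p + u (JT p) *\<^sub>R JT p = 0 *\<^sub>R T p + 0 *\<^sub>R JT p"
      using ne by simp
    then show "u v = 0" using TJT_eqI[OF p, of "u (T p)" "u (JT p)" 0 0] v by auto
  qed simp
  show "span {T p, JT p} = TM p"
  proof
    show "span {T p, JT p} \<subseteq> TM p"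
      using TJT_TM[OF p] by (intro span_minimal subspace_TM p) auto
    show "TM p \<subseteq> span {T p, JT p}"
      using TM_expansion[OF p] by (metis (no_types, lifting) insert_iff span_add span_base span_scale subsetI)
  qed
qed

text \<open>Since \<open>n\<^sub>2\<^sup>2 + n\<^sub>3\<^sup>2 = r\<close> is constant, the normal is determined by the angle of
  \<open>(n\<^sub>2, n\<^sub>3)\<close>; \<open>\<theta>\<close> is the differential of this angle.\<close>

definition "\<theta> p v = (n2 p * sd n3 p v - n3 p * sd n2 p v) / r"

text \<open>Differentiating n2^2 + n3^2 = \<open>r\<close> shows that the derivative of (n2, n3) is
  orthogonal to (n2, n3), hence a multiple of (- n3, n2).\<close>

lemma sd_n:
  assumes p: "p \<in> M" and v: "v \<in> TM p"
  shows "sd n2 p v = - (\<theta> p v * n3 p)" "sd n3 p v = \<theta> p v * n2 p"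
proof -
  note r = r_nonzero[OF p]
  have "sd (\<lambda>q. n2 q * n2 q + n3 q * n3 q) p v = sd (\<lambda>_. r) p v"
    by (intro sd_cong sm_intros sm_n p v n_norm)
  then have *: "n2 p * sd n2 p v + n3 p * sd n3 p v = 0"
    using p v by (simp add: sd_const sd_add sd_mult sm_n sm_mult)
  have \<theta>: "r * \<theta> p v = n2 p * sd n3 p v - n3 p * sd n2 p v" using r by (simp add: \<theta>_def)
  have "r * sd n2 p v = r * - (\<theta> p v * n3 p)" "r * sd n3 p v = r * (\<theta> p v * n2 p)"
    using * \<theta> n_norm[OF p] by algebra+
  from this[THEN mult_left_cancel[OF r, THEN iffD1]]
  show "sd n2 p v = - (\<theta> p v * n3 p)" "sd n3 p v = \<theta> p v * n2 p" .
qed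

text \<open>The value that \<theta>(T) must take for the normal component of [T,JT] to
  vanish.\<close>

definition "\<omega> = lam * r * \<alpha> - lam * \<nu>\<^sup>2 * \<beta>"

lemma bracket_TJT:
  assumes W: "is_lie_bracket G T JT W" and p: "p \<in> M"
  shows "\<theta> p (T p) = \<omega>"
    and "W p = (lam * \<nu> * \<beta>) *\<^sub>R T p - (\<nu> * \<theta> p (JT p)) *\<^sub>R JT p"
proof -
  note o = orthonormal[OF p]
  note T = TJT_TM(1)[OF p] and JT = TJT_TM(2)[OF p]
  define a b where ab: "a = \<theta> p (T p)" "b = \<theta> p (JT p)"
  have W': "W p = (\<nu> * \<beta> * r) *\<^sub>R e1 p + ((a - \<alpha> * (lam * r)) * n2 p - \<nu> * b * n3 p) *\<^sub>R e2 p
      + ((a - \<alpha> * (lam * r)) * n3 p + \<nu> * b * n2 p) *\<^sub>R e3 p"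
  proof -
    have c: "sqrt \<kappa> * \<tau> * ((- \<nu> * n2 p) * (- n2 p) - (- \<nu> * n3 p) * n3 p) = \<nu> * \<beta> * r"
      unfolding n_norm[OF p, symmetric] \<beta>_def by (simp add: algebra_simps)
    show ?thesis
      using p T JT
      by (subst lie_bracket_frame[OF W TJT_flds p sm_const sm_mult[OF sm_const sm_n(1)]
            sm_mult[OF sm_const sm_n(2)] sm_const sm_n(2) sm_uminus[OF sm_n(1)] T_frame JT_frame])
         (simp_all only: c, simp_all add: sd_const sd_cmult sd_minus sm_n sd_n \<alpha>_def[symmetric]
            ab[symmetric] algebra_simps sd_minus[OF _ _ sm_mult[OF sm_const sm_n(1)]]
            sd_minus[OF _ _ sm_mult[OF sm_const sm_n(2)]])
  qed
  have "W p \<in> TM p" using W p by (auto simp: is_lie_bracket_def)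
  then have "g p (N p) (W p) = 0" using N(4)[OF p] by simp
  then have "lam * \<nu> * (\<nu> * \<beta> * r) + n2 p * ((a - \<alpha> * (lam * r)) * n2 p - \<nu> * b * n3 p)
      + n3 p * ((a - \<alpha> * (lam * r)) * n3 p + \<nu> * b * n2 p) = 0"
    by (simp add: W' N_frame[OF p] g_tau_linear o mult.commute)
  then have "r * (lam * \<nu> * (\<nu> * \<beta>) + (a - \<alpha> * (lam * r))) = 0"
    using n_norm[OF p] by algebra
  then have "lam * \<nu> * (\<nu> * \<beta>) + (a - \<alpha> * (lam * r)) = 0"
    using r_nonzero[OF p] by (simp only: mult_eq_0_iff simp_thms)
  then have a: "a = \<omega>"
    by (simp add: \<omega>_def power2_eq_square algebra_simps)
  then show "\<theta> p (T p) = \<omega>" by (simp add: ab)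
  \<comment> \<open>After this substitution the \<open>e1\<close> part and the (n2, n3) part of
    \<open>W p\<close> combine to a multiple of \<open>T p\<close>; the rest is a multiple of
    \<open>JT p\<close>.\<close>
  have A: "a - \<alpha> * (lam * r) = - (lam * \<nu>\<^sup>2 * \<beta>)" by (simp add: a \<omega>_def)
  then show "W p = (lam * \<nu> * \<beta>) *\<^sub>R T p - (\<nu> * \<theta> p (JT p)) *\<^sub>R JT p"
    unfolding W' A ab(2)[symmetric] unfolding T_frame[OF p] JT_frame[OF p]
    by (simp add: algebra_simps power2_eq_square)
qed

text \<open>This is D_JT T = \<mu> \<nu> JT solved for \<mu>. Going through \<open>D\<close> rather
  than \<open>\<theta>\<close> gives smoothness at once, because \<open>D JT T\<close> is a field;
  \<open>D_TJT\<close> identifies it with \<theta>(JT).\<close>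

definition "\<mu> p = g p (D JT T p) (JT p) / (\<nu> * r)"

text \<open>\<open>T\<close> and \<open>JT\<close> are orthogonal of constant length, so a metric connection is given on them
  by one form.\<close>

lemma D_form:
  assumes X: "X \<in> flds G" and p: "p \<in> M"
  shows "D X T p = (g p (D X T p) (JT p) / r) *\<^sub>R JT p"
    "D X JT p = (lam * (g p (D X T p) (JT p) / r)) *\<^sub>R T p"
proof -
  have const: "g p (D X Y p) (Z p) + g p (Y p) (D X Z p) = 0"
    if "Y \<in> flds G" "Z \<in> flds G" "\<And>q. q \<in> M \<Longrightarrow> g q (Y q) (Z q) = k" for Y Z k
  proof -
    have "sd (\<lambda>q. g q (Y q) (Z q)) p (X p) = sd (\<lambda>_. k) p (X p)"
      using X p that(1,2) by (intro sd_cong that sm_g_tau) auto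
    then show ?thesis
      using D_metric[OF X that(1,2) p] X p by (simp add: sd_const)
  qed
  note c = const[OF TJT_flds(1) TJT_flds(1) g_TJT(1)] const[OF TJT_flds(1) TJT_flds(2) g_TJT(3)]
    const[OF TJT_flds(2) TJT_flds(2) g_TJT(2)]
  have DT: "D X T p \<in> TM p" "D X JT p \<in> TM p"
    using D_flds[OF X TJT_flds(1)] D_flds[OF X TJT_flds(2)] p by auto
  have "g p (D X T p) (T p) = 0" "g p (D X JT p) (JT p) = 0"
    "g p (D X JT p) (T p) = - g p (D X T p) (JT p)"
    using c g_tau_commute[of \<kappa> \<tau> "F p" "T p"] g_tau_commute[of \<kappa> \<tau> "F p" "JT p"] by auto
  with TM_expansion[OF p DT(1)] TM_expansion[OF p DT(2)]
  show "D X T p = (g p (D X T p) (JT p) / r) *\<^sub>R JT p"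
    "D X JT p = (lam * (g p (D X T p) (JT p) / r)) *\<^sub>R T p" by simp_all
qed

text \<open>With \<open>a\<close>, \<open>b\<close> the values of the connection form on
  \<open>T\<close> and \<open>JT\<close>, vanishing torsion reads [T,JT] = lam a T - b JT.
  Comparison with \<open>bracket_TJT\<close> gives a = \<nu> \<beta> and b = \<nu>
  \<theta>(JT).\<close>

lemma D_TJT:
  assumes p: "p \<in> M"
  shows "D T T p = (\<nu> * \<beta>) *\<^sub>R JT p" "D JT T p = (\<mu> p * \<nu>) *\<^sub>R JT p"
    "D T JT p = (lam * \<nu> * \<beta>) *\<^sub>R T p" "D JT JT p = (lam * \<mu> p * \<nu>) *\<^sub>R T p"
    "\<theta> p (T p) = \<omega>" "\<theta> p (JT p) = \<mu> p"
proof -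
  define a b where ab: "a = g p (D T T p) (JT p) / r" "b = g p (D JT T p) (JT p) / r"
  note D = D_form[OF TJT_flds(1) p, folded ab] D_form[OF TJT_flds(2) p, folded ab]
  have b: "b = \<mu> p * \<nu>" using nu by (simp add: ab \<mu>_def)
  note W = bracket_TJT[OF D_torsion[OF TJT_flds] p]
  show "\<theta> p (T p) = \<omega>" by (rule W(1))
  have eq: "(lam * a) *\<^sub>R T p + (- b) *\<^sub>R JT p = (lam * \<nu> * \<beta>) *\<^sub>R T p + (- \<nu> * \<theta> p (JT p)) *\<^sub>R JT p"
    using W(2) by (simp add: D)
  have "lam * a = lam * (\<nu> * \<beta>)" using TJT_eqI(1)[OF p eq] by simp
  then have a: "a = \<nu> * \<beta>" by simp
  show "\<theta> p (JT p) = \<mu> p" using TJT_eqI(2)[OF p eq] nu by (simp add: b)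
  show "D T T p = (\<nu> * \<beta>) *\<^sub>R JT p" "D JT T p = (\<mu> p * \<nu>) *\<^sub>R JT p"
    "D T JT p = (lam * \<nu> * \<beta>) *\<^sub>R T p" "D JT JT p = (lam * \<mu> p * \<nu>) *\<^sub>R T p"
    using D by (simp_all add: a b mult.assoc)
qed

lemma sm_mu: "sm \<mu>"
proof -
  have "sm (D JT T)" "sm JT" using D_flds[OF TJT_flds(2,1)] TJT_flds(2) by auto
  then have "sm (\<lambda>p. (1 / (\<nu> * r)) * g p (D JT T p) (JT p))" by (intro sm_intros sm_g_tau)
  then show ?thesis by (simp add: \<mu>_def[abs_def])
qed

lemma T_mu:
  assumes p: "p \<in> M"
  shows "sd \<mu> p (T p) = lam * \<nu> * \<beta> * \<omega> - \<nu> * (\<mu> p)\<^sup>2"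
proof -
  note T = TJT_TM(1)[OF p] and J = TJT_TM(2)[OF p]
  define W where "W = (\<lambda>p. D T JT p - D JT T p)"
  have W: "is_lie_bracket G T JT W" unfolding W_def by (rule D_torsion[OF TJT_flds])
  have Wp: "W p = (lam * \<nu> * \<beta>) *\<^sub>R T p + (- \<nu> * \<mu> p) *\<^sub>R JT p"
    using bracket_TJT(2)[OF W p] by (simp add: D_TJT(6)[OF p])
  have br: "sd f p (W p) = sd (\<lambda>q. sd f q (JT q)) p (T p) - sd (\<lambda>q. sd f q (T q)) p (JT p)"
    if "sm f" for f using W p that by (simp add: is_lie_bracket_def)
  have d: "sd n2 q (T q) = - (\<omega> * n3 q)" "sd n3 q (T q) = \<omega> * n2 q"
    "sd n2 q (JT q) = - (\<mu> q * n3 q)" "sd n3 q (JT q) = \<mu> q * n2 q" if "q \<in> M" for q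
    using that by (simp_all add: sd_n TJT_TM D_TJT)
  have c: "sd (\<lambda>q. sd n2 q (JT q)) p v = - (sd \<mu> p v * n3 p + \<mu> p * sd n3 p v)"
    "sd (\<lambda>q. sd n3 q (JT q)) p v = sd \<mu> p v * n2 p + \<mu> p * sd n2 p v"
    "sd (\<lambda>q. sd n2 q (T q)) p v = - (\<omega> * sd n3 p v)"
    "sd (\<lambda>q. sd n3 q (T q)) p v = \<omega> * sd n2 p v" if v: "v \<in> TM p" for v
  proof -
    have "sd (\<lambda>q. - (\<mu> q * n3 q)) p v = sd (\<lambda>q. sd n2 q (JT q)) p v"
      "sd (\<lambda>q. \<mu> q * n2 q) p v = sd (\<lambda>q. sd n3 q (JT q)) p v"
      "sd (\<lambda>q. - (\<omega> * n3 q)) p v = sd (\<lambda>q. sd n2 q (T q)) p v"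
      "sd (\<lambda>q. \<omega> * n2 q) p v = sd (\<lambda>q. sd n3 q (T q)) p v"
      by (intro sd_cong p v sm_intros sm_mu sm_n, simp add: d)+
    then show "sd (\<lambda>q. sd n2 q (JT q)) p v = - (sd \<mu> p v * n3 p + \<mu> p * sd n3 p v)"
      "sd (\<lambda>q. sd n3 q (JT q)) p v = sd \<mu> p v * n2 p + \<mu> p * sd n2 p v"
      "sd (\<lambda>q. sd n2 q (T q)) p v = - (\<omega> * sd n3 p v)"
      "sd (\<lambda>q. sd n3 q (T q)) p v = \<omega> * sd n2 p v"
      using p v by (simp_all add: sd_mult sd_minus sd_const sm_intros sm_mu sm_n)
  qed
  have "sd n2 p (W p) = (lam * \<nu> * \<beta>) * sd n2 p (T p) + (- \<nu> * \<mu> p) * sd n2 p (JT p)"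
    "sd n3 p (W p) = (lam * \<nu> * \<beta>) * sd n3 p (T p) + (- \<nu> * \<mu> p) * sd n3 p (JT p)"
    unfolding Wp by (rule sd_linear[OF p T J], rule sm_n)+
  \<comment> \<open>The products of \<theta>(T) and \<theta>(JT) cancel between the two iterated
    derivatives. What remains is the claim multiplied by \<open>n3 p\<close> and by
    \<open>n2 p\<close>, which cannot both vanish.\<close>
  then have "n3 p * sd \<mu> p (T p) = n3 p * (lam * \<nu> * \<beta> * \<omega> - \<nu> * (\<mu> p)\<^sup>2)"
    "n2 p * sd \<mu> p (T p) = n2 p * (lam * \<nu> * \<beta> * \<omega> - \<nu> * (\<mu> p)\<^sup>2)"
    unfolding br[OF sm_n(1)] br[OF sm_n(2)] c[OF T] c[OF J] d[OF p]
    by (simp_all add: algebra_simps power2_eq_square)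
  moreover have "n2 p \<noteq> 0 \<or> n3 p \<noteq> 0" using n_norm[OF p] r_nonzero[OF p] by auto
  ultimately show ?thesis by auto
qed

text \<open>By \<open>alpha_beta\<close> the constant in \<open>T_mu\<close> is \<kappa> \<nu> (r -
  \<nu>^2 \<tau>^2), and r = lam + \<nu>^2 turns this into - \<kappa> \<nu> B.\<close>

lemma riccati:
  assumes p: "p \<in> M"
  shows "sd \<mu> p (T p) + \<nu> * (\<mu> p)\<^sup>2 + \<kappa> * \<nu> * (\<nu>\<^sup>2 * (\<tau>\<^sup>2 - 1) - lam) = 0"
proof -
  have "lam * \<nu> * \<beta> * \<omega> = \<nu> * (r * (\<alpha> * \<beta>) - \<nu>\<^sup>2 * (\<beta> * \<beta>))"
    unfolding \<omega>_def by (simp add: algebra_simps)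
  then show ?thesis unfolding T_mu[OF p] alpha_beta r_def by (simp add: algebra_simps)
qed

section \<open>Curvature from the connection form\<close>

lemma flds_components:
  assumes X: "X \<in> flds G"
  obtains x1 x2 where "sm x1" "sm x2" "\<And>q. q \<in> M \<Longrightarrow> X q = x1 q *\<^sub>R T q + x2 q *\<^sub>R JT q"
proof -
  have sm: "sm X" "sm T" "sm JT" using X TJT_flds by auto
  show thesis
  proof (rule that)
    show "sm (\<lambda>q. - lam / r * g q (X q) (T q))" "sm (\<lambda>q. 1 / r * g q (X q) (JT q))"
      by (intro sm_intros sm_g_tau sm)+
    show "X q = (- lam / r * g q (X q) (T q)) *\<^sub>R T q + (1 / r * g q (X q) (JT q)) *\<^sub>R JT q"
      if "q \<in> M" for q
      using TM_expansion[OF that, of "X q"] X that by simp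
  qed
qed

text \<open>The connection form eta on a T + b JT, with D_X T = eta(X) JT and D_X JT = lam eta(X)
  T.\<close>

definition form :: "real \<Rightarrow> real \<Rightarrow> 'm \<Rightarrow> real" where
  "form a b q = a * (\<nu> * \<beta>) + b * (\<mu> q * \<nu>)"

lemma D_components:
  assumes "X \<in> flds G" "Y \<in> flds G" and p: "p \<in> M"
    and sm: "sm x1" "sm x2" "sm y1" "sm y2"
    and X: "\<And>q. q \<in> M \<Longrightarrow> X q = x1 q *\<^sub>R T q + x2 q *\<^sub>R JT q"
    and Y: "\<And>q. q \<in> M \<Longrightarrow> Y q = y1 q *\<^sub>R T q + y2 q *\<^sub>R JT q"
  shows "D X Y p = (sd y1 p (X p) + lam * form (x1 p) (x2 p) p * y2 p) *\<^sub>R T p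
    + (sd y2 p (X p) + form (x1 p) (x2 p) p * y1 p) *\<^sub>R JT p"
proof -
  note TJ = TJT_flds
  have D1: "D X Z p = x1 p *\<^sub>R D T Z p + x2 p *\<^sub>R D JT Z p" if Z: "Z \<in> flds G" for Z
  proof -
    have "D X Z p = D (\<lambda>q. x1 q *\<^sub>R T q + x2 q *\<^sub>R JT q) Z p"
      using assms(1) TJ Z p sm X by (intro D_cong flds_add flds_scale) auto
    then show ?thesis
      using TJ Z p sm by (simp only: D_add1 D_scale1 flds_scale)
  qed
  have "D X Y p = D X (\<lambda>q. y1 q *\<^sub>R T q + y2 q *\<^sub>R JT q) p"
    using assms(1,2) TJ p sm Y by (intro D_cong flds_add flds_scale) auto
  also have "\<dots> = sd y1 p (X p) *\<^sub>R T p + y1 p *\<^sub>R D X T p + (sd y2 p (X p) *\<^sub>R JT p + y2 p *\<^sub>R D X JT p)"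
    using assms(1) TJ p sm by (simp only: D_add2 D_scale2 flds_scale)
  finally show ?thesis
    by (simp add: D1[OF TJ(1)] D1[OF TJ(2)] D_TJT[OF p] form_def algebra_simps)
qed

text \<open>The connection matrix is eta(X) times a fixed matrix, so the terms quadratic in eta
  cancel and the curvature is d eta(X,Y) times that matrix. \<open>riccati\<close> then eliminates
  the derivative of \<open>\<mu>\<close>.\<close>

lemma gaussian_curvature:
  "has_gaussian_curvature G D (\<lambda>p. lam * \<kappa> * \<nu>\<^sup>2 * (1 - \<tau>\<^sup>2))"
  unfolding has_gaussian_curvature_def Let_def geometry_simps(1,4)
proof (intro ballI allI impI)
  fix X Y W p
  assume XY: "X \<in> flds G" "Y \<in> flds G" and W: "is_lie_bracket G X Y W" and p: "p \<in> M"
    and Q: "g p (X p) (X p) * g p (Y p) (Y p) - (g p (X p) (Y p))\<^sup>2 \<noteq> 0"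
  obtain x1 x2 where x: "sm x1" "sm x2" "\<And>q. q \<in> M \<Longrightarrow> X q = x1 q *\<^sub>R T q + x2 q *\<^sub>R JT q"
    using flds_components[OF XY(1)] by blast
  obtain y1 y2 where y: "sm y1" "sm y2" "\<And>q. q \<in> M \<Longrightarrow> Y q = y1 q *\<^sub>R T q + y2 q *\<^sub>R JT q"
    using flds_components[OF XY(2)] by blast
  have Xp: "X p \<in> TM p" and Yp: "Y p \<in> TM p" using XY p by auto
  define fX where "fX = (\<lambda>q. form (x1 q) (x2 q) q)"
  define fY where "fY = (\<lambda>q. form (y1 q) (y2 q) q)"
  have smf: "sm fX" "sm fY"
    unfolding fX_def fY_def form_def by (intro sm_intros x y sm_mu)+
  have DXY: "D X Y q = (sd y1 q (X q) + lam * fX q * y2 q) *\<^sub>R T q + (sd y2 q (X q) + fX q * y1 q) *\<^sub>R JT q"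
    and DYY: "D Y Y q = (sd y1 q (Y q) + lam * fY q * y2 q) *\<^sub>R T q + (sd y2 q (Y q) + fY q * y1 q) *\<^sub>R JT q"
    and DYX: "D Y X q = (sd x1 q (Y q) + lam * fY q * x2 q) *\<^sub>R T q + (sd x2 q (Y q) + fY q * x1 q) *\<^sub>R JT q"
    if "q \<in> M" for q
    unfolding fX_def fY_def
    by (rule D_components[OF XY(1,2) that x(1,2) y(1,2) x(3) y(3)]
        D_components[OF XY(2,2) that y(1,2) y(1,2) y(3) y(3)]
        D_components[OF XY(2,1) that y(1,2) x(1,2) y(3) x(3)]; assumption)+
  \<comment> \<open>The components of the field \<open>D Z Y\<close> are smooth; subtracting the
    connection terms leaves exactly these derivatives.\<close>
  have sm_deriv: "sm (\<lambda>q. sd y1 q (Z q))" "sm (\<lambda>q. sd y2 q (Z q))"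
    if Z: "Z \<in> flds G" and z: "sm z1" "sm z2" "\<And>q. q \<in> M \<Longrightarrow> Z q = z1 q *\<^sub>R T q + z2 q *\<^sub>R JT q"
    for Z z1 z2
  proof -
    define f where "f = (\<lambda>q. form (z1 q) (z2 q) q)"
    have smf: "sm f" unfolding f_def form_def by (intro sm_intros z sm_mu)
    obtain c1 c2 where c: "sm c1" "sm c2" "\<And>q. q \<in> M \<Longrightarrow> D Z Y q = c1 q *\<^sub>R T q + c2 q *\<^sub>R JT q"
      using flds_components[OF D_flds[OF Z XY(2)]] by blast
    have "c1 q = sd y1 q (Z q) + lam * f q * y2 q" "c2 q = sd y2 q (Z q) + f q * y1 q"
      if "q \<in> M" for q
      using TJT_eqI[OF that, OF trans[OF c(3)[OF that, symmetric]
          D_components[OF Z XY(2) that z(1,2) y(1,2) z(3) y(3)]]] unfolding f_def by blast+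
    then have e: "c1 q - lam * f q * y2 q = sd y1 q (Z q)" "c2 q - f q * y1 q = sd y2 q (Z q)"
      if "q \<in> M" for q using that by simp_all
    show "sm (\<lambda>q. sd y1 q (Z q))"
      by (rule sm_cong[OF e(1)], assumption) (intro sm_intros c y smf)
    show "sm (\<lambda>q. sd y2 q (Z q))"
      by (rule sm_cong[OF e(2)], assumption) (intro sm_intros c y smf)
  qed
  note smX = sm_deriv[OF XY(1) x] and smY = sm_deriv[OF XY(2) y]
  define w1 w2 where w: "w1 = sd y1 p (X p) + lam * fX p * y2 p - (sd x1 p (Y p) + lam * fY p * x2 p)"
    "w2 = sd y2 p (X p) + fX p * y1 p - (sd x2 p (Y p) + fY p * x1 p)"
  have Wp: "W p = w1 *\<^sub>R T p + w2 *\<^sub>R JT p"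
    unfolding lie_bracket_unique[OF W D_torsion[OF XY] XY p] DXY[OF p] DYX[OF p] w
    by (simp add: algebra_simps)
  note smYY = sm_add[OF smY(1) sm_mult[OF sm_mult[OF sm_const[of lam] smf(2)] y(2)]]
    sm_add[OF smY(2) sm_mult[OF smf(2) y(1)]]
  note smXY = sm_add[OF smX(1) sm_mult[OF sm_mult[OF sm_const[of lam] smf(1)] y(2)]]
    sm_add[OF smX(2) sm_mult[OF smf(1) y(1)]]
  have DXDYY: "D X (D Y Y) p =
      (sd (\<lambda>q. sd y1 q (Y q) + lam * fY q * y2 q) p (X p) + lam * fX p * (sd y2 p (Y p) + fY p * y1 p)) *\<^sub>R T p
      + (sd (\<lambda>q. sd y2 q (Y q) + fY q * y1 q) p (X p) + fX p * (sd y1 p (Y p) + lam * fY p * y2 p)) *\<^sub>R JT p"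
    unfolding fX_def
    by (rule D_components[OF XY(1) D_flds[OF XY(2,2)] p x(1,2) smYY x(3) DYY])
  have DYDXY: "D Y (D X Y) p =
      (sd (\<lambda>q. sd y1 q (X q) + lam * fX q * y2 q) p (Y p) + lam * fY p * (sd y2 p (X p) + fX p * y1 p)) *\<^sub>R T p
      + (sd (\<lambda>q. sd y2 q (X q) + fX q * y1 q) p (Y p) + fY p * (sd y1 p (X p) + lam * fX p * y2 p)) *\<^sub>R JT p"
    unfolding fY_def
    by (rule D_components[OF XY(2) D_flds[OF XY(1,2)] p y(1,2) smXY y(3) DXY])
  have WG: "W \<in> flds G" using W by (simp add: is_lie_bracket_def)
  \<comment> \<open>\<open>D_components\<close> asks for coefficient functions on the whole surface,
    whereas \<open>w1\<close> and \<open>w2\<close> are only values at \<open>p\<close>.\<close>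
  obtain u1 u2 where u: "sm u1" "sm u2" "\<And>q. q \<in> M \<Longrightarrow> W q = u1 q *\<^sub>R T q + u2 q *\<^sub>R JT q"
    using flds_components[OF WG] by blast
  have uw: "u1 p = w1" "u2 p = w2"
    using TJT_eqI[OF p, OF trans[OF u(3)[OF p, symmetric] Wp]] by blast+
  have br: "sd f p (W p) = sd (\<lambda>q. sd f q (Y q)) p (X p) - sd (\<lambda>q. sd f q (X q)) p (Y p)"
    if "sm f" for f using W p that by (simp add: is_lie_bracket_def)
  define fW where "fW = form w1 w2 p"
  \<comment> \<open>Writing the derivatives along the bracket as commutators makes the second
    derivatives of \<open>y1\<close> and \<open>y2\<close> cancel in the curvature.\<close>
  have DWY: "D W Y p = (sd (\<lambda>q. sd y1 q (Y q)) p (X p) - sd (\<lambda>q. sd y1 q (X q)) p (Y p) + lam * fW * y2 p) *\<^sub>R T p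
      + (sd (\<lambda>q. sd y2 q (Y q)) p (X p) - sd (\<lambda>q. sd y2 q (X q)) p (Y p) + fW * y1 p) *\<^sub>R JT p"
    unfolding fW_def br[OF y(1), symmetric] br[OF y(2), symmetric]
    using D_components[OF WG XY(2) p u(1,2) y(1,2) u(3) y(3)] by (simp add: uw)
  \<comment> \<open>This is d eta(X,Y) at \<open>p\<close>.\<close>
  define \<Omega> where "\<Omega> = sd fY p (X p) - sd fX p (Y p) - fW"
  have R: "D X (D Y Y) p - D Y (D X Y) p - D W Y p = (lam * \<Omega> * y2 p) *\<^sub>R T p + (\<Omega> * y1 p) *\<^sub>R JT p"
    unfolding DXDYY DYDXY DWY \<Omega>_def
    using p Xp Yp smX smY smf y
    by (simp add: sd_add sd_mult sd_const sm_mult sm_const algebra_simps)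
  define \<Delta> where "\<Delta> = x1 p * y2 p - x2 p * y1 p"
  have dmu: "sd \<mu> p (X p) = x1 p * sd \<mu> p (T p) + x2 p * sd \<mu> p (JT p)"
    "sd \<mu> p (Y p) = y1 p * sd \<mu> p (T p) + y2 p * sd \<mu> p (JT p)"
    unfolding x(3)[OF p] y(3)[OF p] by (rule sd_linear[OF p TJT_TM[OF p] sm_mu])+
  have df: "sd fY p (X p) = sd y1 p (X p) * (\<nu> * \<beta>) + (sd y2 p (X p) * (\<mu> p * \<nu>) + y2 p * (sd \<mu> p (X p) * \<nu>))"
    "sd fX p (Y p) = sd x1 p (Y p) * (\<nu> * \<beta>) + (sd x2 p (Y p) * (\<mu> p * \<nu>) + x2 p * (sd \<mu> p (Y p) * \<nu>))"
    unfolding fX_def fY_def form_def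
    using p Xp Yp x y sm_mu by (simp_all add: sd_add sd_mult sd_const sm_mult sm_const)
  \<comment> \<open>A 2-form on the surface is its value on (T,JT) times the determinant \<Delta> of
    (X,Y) in that basis.\<close>
  have "\<Omega> = \<Delta> * (\<nu> * sd \<mu> p (T p) - lam * (\<nu> * \<beta>)\<^sup>2 + (\<nu> * \<mu> p)\<^sup>2)"
    unfolding \<Omega>_def df dmu fW_def w unfolding fX_def fY_def form_def \<Delta>_def
    by (simp add: algebra_simps power2_eq_square)
  also have "sd \<mu> p (T p) = - (\<nu> * (\<mu> p)\<^sup>2 + \<kappa> * \<nu> * (\<nu>\<^sup>2 * (\<tau>\<^sup>2 - 1) - lam))"
    using riccati[OF p] by linarith
  also have "\<nu> * - (\<nu> * (\<mu> p)\<^sup>2 + \<kappa> * \<nu> * (\<nu>\<^sup>2 * (\<tau>\<^sup>2 - 1) - lam)) - lam * (\<nu> * \<beta>)\<^sup>2 + (\<nu> * \<mu> p)\<^sup>2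
      = \<kappa> * \<nu>\<^sup>2 * (1 - \<tau>\<^sup>2) * r"
    unfolding power_mult_distrib power2_eq_square[of \<beta>] alpha_beta r_def
    by (simp add: algebra_simps power2_eq_square)
  finally have \<Omega>: "\<Omega> = \<Delta> * (\<kappa> * \<nu>\<^sup>2 * (1 - \<tau>\<^sup>2) * r)" .
  note gs = g_tau_linear g_TJT[OF p]
  \<comment> \<open>The Gram determinant of (T,JT) is - lam r^2; a change of basis multiplies it by
    \<Delta>^2.\<close>
  have Q': "g p (X p) (X p) * g p (Y p) (Y p) - (g p (X p) (Y p))\<^sup>2 = - (lam * (r * \<Delta>)\<^sup>2)"
    unfolding x(3)[OF p] y(3)[OF p] \<Delta>_def by (simp add: gs algebra_simps power2_eq_square)
  have num: "g p (D X (D Y Y) p - D Y (D X Y) p - D W Y p) (X p) = - (\<Omega> * r * \<Delta>)"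
    unfolding R x(3)[OF p] \<Delta>_def by (simp add: gs algebra_simps)
  have "\<Delta> \<noteq> 0" using Q unfolding Q' by auto
  then have "lam * \<kappa> * \<nu>\<^sup>2 * (1 - \<tau>\<^sup>2) = - (\<Omega> * r * \<Delta>) / - (lam * (r * \<Delta>)\<^sup>2)"
    using r_nonzero[OF p] unfolding \<Omega> by (simp add: divide_simps power2_eq_square)
  then show "lam * \<kappa> * \<nu>\<^sup>2 * (1 - \<tau>\<^sup>2) = g p (D X (D Y Y) p - D Y (D X Y) p - D W Y p) (X p) /
      (g p (X p) (X p) * g p (Y p) (Y p) - (g p (X p) (Y p))\<^sup>2)"
    unfolding num Q' .
qed

end

section \<open>The shape operator\<close>

locale helix_shape = helix \<kappa> \<tau> S Atl F D lam \<nu> N + ambient_connection \<kappa> \<tau> DH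
  for \<kappa> \<tau> and S :: "'m topology" and Atl and F and D and lam \<nu> and N and DH +
  fixes P :: "('m \<Rightarrow> real^4) \<Rightarrow> ('m \<Rightarrow> real^4) \<Rightarrow> 'm \<Rightarrow> real^4"
  assumes along: "connection_along \<kappa> \<tau> S Atl F DH P"
begin

abbreviation "H \<equiv> AdS_geometry \<kappa> \<tau>"
abbreviation "\<Gamma> \<equiv> fields_along S Atl F"

lemma P_add: "X \<in> flds G \<Longrightarrow> V \<in> \<Gamma> \<Longrightarrow> V' \<in> \<Gamma> \<Longrightarrow> p \<in> M \<Longrightarrow>
    P X (\<lambda>q. V q + V' q) p = P X V p + P X V' p"
  and P_scale: "sm f \<Longrightarrow> X \<in> flds G \<Longrightarrow> V \<in> \<Gamma> \<Longrightarrow> p \<in> M \<Longrightarrow>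
    P X (\<lambda>q. f q *\<^sub>R V q) p = sd f p (X p) *\<^sub>R V p + f p *\<^sub>R P X V p"
  and P_ambient: "X \<in> flds G \<Longrightarrow> Y \<in> flds H \<Longrightarrow> Z \<in> flds H \<Longrightarrow> p \<in> M \<Longrightarrow> Z (F p) = X p \<Longrightarrow>
    P X (\<lambda>q. Y (F q)) p = DH Z Y (F p)"
  using along unfolding connection_along_def Let_def geometry_simps(1-4) mem_Collect_eq by blast+

lemma Gamma_add: "V \<in> \<Gamma> \<Longrightarrow> V' \<in> \<Gamma> \<Longrightarrow> (\<lambda>q. V q + V' q) \<in> \<Gamma>"
  and Gamma_diff: "V \<in> \<Gamma> \<Longrightarrow> V' \<in> \<Gamma> \<Longrightarrow> (\<lambda>q. V q - V' q) \<in> \<Gamma>"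
  and Gamma_scale: "sm f \<Longrightarrow> V \<in> \<Gamma> \<Longrightarrow> (\<lambda>q. f q *\<^sub>R V q) \<in> \<Gamma>"
  using subspace_add[OF subspace_AdS_tangent] subspace_diff[OF subspace_AdS_tangent]
    subspace_scale[OF subspace_AdS_tangent]
  by (auto simp: fields_along_def intro: sm_intros)

lemma Gamma_frame: "(\<lambda>q. e1 q) \<in> \<Gamma>" "(\<lambda>q. e2 q) \<in> \<Gamma>" "(\<lambda>q. e3 q) \<in> \<Gamma>"
  by (auto simp: fields_along_def frame_tangent intro!: sm_frame sm_F)

text \<open>The indicator device of \<open>D_cong\<close>, applied to fields along the
  immersion.\<close>

lemma P_cong:
  assumes "X \<in> flds G" "V \<in> \<Gamma>" "V' \<in> \<Gamma>" "p \<in> M" "\<And>q. q \<in> M \<Longrightarrow> V q = V' q"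
  shows "P X V p = P X V' p"
proof -
  define f :: "'m \<Rightarrow> real" where "f = (\<lambda>q. if q \<in> M then 0 else 1)"
  have f: "sm f" "f p = 0" "sd f p (X p) = 0"
    using sm_off sd_off assms(1,4) by (auto simp: f_def)
  have V: "V = (\<lambda>q. V' q + f q *\<^sub>R (V q - V' q))"
    using assms(5) by (auto simp: f_def)
  have "P X V p = P X (\<lambda>q. V' q + f q *\<^sub>R (V q - V' q)) p"
    by (rule arg_cong[OF V, of "\<lambda>V. P X V p"])
  also have "\<dots> = P X V' p + P X (\<lambda>q. f q *\<^sub>R (V q - V' q)) p"
    by (intro P_add assms Gamma_scale Gamma_diff f)
  also have "P X (\<lambda>q. f q *\<^sub>R (V q - V' q)) p = 0"
    using P_scale[OF f(1) assms(1) Gamma_diff[OF assms(2,3)] assms(4)] f by simp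
  finally show ?thesis by simp
qed

lemma H_simps: "pts H = AdS \<kappa>" "fns H = {f. AdS_smooth \<kappa> f}"
  by (simp_all add: AdS_geometry_def)

lemma DH_affine: "affine_connection H DH"
  using DH by (simp add: levi_civita_def)

lemma H_add:
  assumes "X \<in> flds H" "Y \<in> flds H" "q \<in> AdS \<kappa>" "Z \<in> flds H"
  shows "DH (\<lambda>q. X q + Y q) Z q = DH X Z q + DH Y Z q"
proof -
  have "\<forall>X\<in>flds H. \<forall>X'\<in>flds H. \<forall>Y\<in>flds H. \<forall>p\<in>pts H.
      DH (\<lambda>q. X q + X' q) Y p = DH X Y p + DH X' Y p"
    using DH_affine unfolding affine_connection_def by (elim conjE)
  then show ?thesis using assms unfolding H_simps by blast
qed

lemma H_scale:
  assumes "X \<in> flds H" "q \<in> AdS \<kappa>" "Z \<in> flds H"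
  shows "DH (\<lambda>q. c *\<^sub>R X q) Z q = c *\<^sub>R DH X Z q"
proof -
  have "\<forall>f\<in>fns H. \<forall>X\<in>flds H. \<forall>Y\<in>flds H. \<forall>p\<in>pts H.
      DH (\<lambda>q. f q *\<^sub>R X q) Y p = f p *\<^sub>R DH X Y p"
    using DH_affine unfolding affine_connection_def by (elim conjE)
  from bspec[OF this, of "\<lambda>_. c"] show ?thesis
    using assms AdS_smooth_const[of \<kappa> c] unfolding H_simps by simp
qed

lemma linear_flds_H:
  "linear X \<Longrightarrow> (\<And>q. X q \<in> AdS_tangent q) \<Longrightarrow> X \<in> flds H"
  by (simp add: AdS_geometry_def AdS_smooth_linear)

text \<open>\<open>P_ambient\<close> needs an ambient field through the vector \<open>X p\<close>.
  The combination of the frame fields with the constant coefficients \<open>x1\<close>,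
  \<open>x2\<close>, \<open>x3\<close> is one, and \<open>DH\<close> is linear in it.\<close>

lemma P_frame:
  assumes "X \<in> flds G" "p \<in> M" "Y \<in> frame_fields \<kappa> \<tau>"
    and X: "X p = x1 *\<^sub>R e1 p + x2 *\<^sub>R e2 p + x3 *\<^sub>R e3 p"
  shows "P X (\<lambda>q. Y (F q)) p = x1 *\<^sub>R DH (E1 \<kappa> \<tau>) Y (F p) + x2 *\<^sub>R DH (E2 \<kappa>) Y (F p)
    + x3 *\<^sub>R DH (E3 \<kappa>) Y (F p)"
proof -
  note s = subspace_AdS_tangent
  note tan = subspace_add[OF s] subspace_scale[OF s] frame_tangent
  note lin = linear_compose_add linear_compose_scale_right linear_frame
  have fl: "E1 \<kappa> \<tau> \<in> flds H" "E2 \<kappa> \<in> flds H" "E3 \<kappa> \<in> flds H" "Y \<in> flds H"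
    using assms(3) by (auto intro!: frame_fields_flds simp: frame_fields_def)
  have fl': "(\<lambda>q. x1 *\<^sub>R E1 \<kappa> \<tau> q) \<in> flds H" "(\<lambda>q. x2 *\<^sub>R E2 \<kappa> q) \<in> flds H" "(\<lambda>q. x3 *\<^sub>R E3 \<kappa> q) \<in> flds H"
    "(\<lambda>q. x1 *\<^sub>R E1 \<kappa> \<tau> q + x2 *\<^sub>R E2 \<kappa> q) \<in> flds H"
    "(\<lambda>q. x1 *\<^sub>R E1 \<kappa> \<tau> q + x2 *\<^sub>R E2 \<kappa> q + x3 *\<^sub>R E3 \<kappa> q) \<in> flds H"
    by (intro linear_flds_H tan lin)+
  have "P X (\<lambda>q. Y (F q)) p = DH (\<lambda>q. x1 *\<^sub>R E1 \<kappa> \<tau> q + x2 *\<^sub>R E2 \<kappa> q + x3 *\<^sub>R E3 \<kappa> q) Y (F p)"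
    using X by (intro P_ambient assms(1,2) fl fl') simp
  then show ?thesis
    using fl fl' F_AdS[OF assms(2)] by (simp only: H_add H_scale)
qed

text \<open>Leibniz rule for the frame expansion of \<open>N\<close>: its coefficients turn by
  \<open>\<theta>\<close>, and its frame fields are differentiated by
  \<open>DH_frame\<close>.\<close>

lemma P_N:
  assumes X: "X \<in> flds G" and p: "p \<in> M" and Xp: "X p = x1 *\<^sub>R e1 p + x2 *\<^sub>R e2 p + x3 *\<^sub>R e3 p"
  shows "P X N p = (\<beta> / 2 * (n3 p * x2 - n2 p * x3)) *\<^sub>R e1 p
    + (- \<theta> p (X p) * n3 p + lam * \<nu> * \<beta> / 2 * x3 - (\<beta> / 2 - \<alpha>) * n3 p * x1) *\<^sub>R e2 p
    + (\<theta> p (X p) * n2 p - lam * \<nu> * \<beta> / 2 * x2 + (\<beta> / 2 - \<alpha>) * n2 p * x1) *\<^sub>R e3 p"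
proof -
  have N_\<Gamma>: "N \<in> \<Gamma>" using N by (simp add: fields_along_def)
  have XT: "X p \<in> TM p" using X p by auto
  have c\<Gamma>: "(\<lambda>q. (- lam * \<nu>) *\<^sub>R e1 q) \<in> \<Gamma>" "(\<lambda>q. n2 q *\<^sub>R e2 q) \<in> \<Gamma>" "(\<lambda>q. n3 q *\<^sub>R e3 q) \<in> \<Gamma>"
    "(\<lambda>q. (- lam * \<nu>) *\<^sub>R e1 q + n2 q *\<^sub>R e2 q) \<in> \<Gamma>"
    by (intro Gamma_add Gamma_scale Gamma_frame sm_n sm_const)+
  have "P X N p = P X (\<lambda>q. (- lam * \<nu>) *\<^sub>R e1 q + n2 q *\<^sub>R e2 q + n3 q *\<^sub>R e3 q) p"
    by (intro P_cong X N_\<Gamma> Gamma_add[OF c\<Gamma>(4,3)] p N_frame)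
  also have "\<dots> = (- lam * \<nu>) *\<^sub>R P X (\<lambda>q. e1 q) p
      + (sd n2 p (X p) *\<^sub>R e2 p + n2 p *\<^sub>R P X (\<lambda>q. e2 q) p)
      + (sd n3 p (X p) *\<^sub>R e3 p + n3 p *\<^sub>R P X (\<lambda>q. e3 q) p)"
    using P_add[OF X c\<Gamma>(4,3) p] P_add[OF X c\<Gamma>(1,2) p]
      P_scale[OF sm_const X Gamma_frame(1) p, of "- lam * \<nu>"]
      P_scale[OF sm_n(1) X Gamma_frame(2) p] P_scale[OF sm_n(2) X Gamma_frame(3) p] p XT
    by (simp add: sd_const)
  moreover have "P X (\<lambda>q. e1 q) p = x2 *\<^sub>R ((\<beta> / 2) *\<^sub>R e3 p) + x3 *\<^sub>R ((- \<beta> / 2) *\<^sub>R e2 p)"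
    "P X (\<lambda>q. e2 q) p = x1 *\<^sub>R ((\<beta> / 2 - \<alpha>) *\<^sub>R e3 p) + x3 *\<^sub>R ((- \<beta> / 2) *\<^sub>R e1 p)"
    "P X (\<lambda>q. e3 q) p = x1 *\<^sub>R ((\<alpha> - \<beta> / 2) *\<^sub>R e2 p) + x2 *\<^sub>R ((\<beta> / 2) *\<^sub>R e1 p)"
    using P_frame[OF X p _ Xp, of "E1 \<kappa> \<tau>"] P_frame[OF X p _ Xp, of "E2 \<kappa>"]
      P_frame[OF X p _ Xp, of "E3 \<kappa>"] DH_frame[OF F_AdS[OF p]]
    by (simp_all add: frame_fields_def \<alpha>_def \<beta>_def)
  ultimately show ?thesis
    by (simp add: sd_n[OF p XT] algebra_simps)
qed

lemma shape_TJT: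
  assumes p: "p \<in> M"
  shows "shape_operator P N T p = (\<beta> / 2) *\<^sub>R JT p"
    "shape_operator P N JT p = - (lam * \<beta> / 2) *\<^sub>R T p + \<mu> p *\<^sub>R JT p"
proof -
  have T: "P T N p = - ((\<beta> / 2) *\<^sub>R JT p)"
  proof -
    \<comment> \<open>Inserting \<open>\<omega>\<close> cancels the \<open>\<alpha>\<close> terms
      and leaves lam \<beta>/2 (r - \<nu>^2), which is \<beta>/2 because r - \<nu>^2 = lam.\<close>
    have "\<omega> + lam * \<nu> * \<beta> / 2 * \<nu> + (\<beta> / 2 - \<alpha>) * (lam * r) = \<beta> / 2"
      by (simp add: \<omega>_def r_def power2_eq_square algebra_simps)
    then have "(\<omega> + lam * \<nu> * \<beta> / 2 * \<nu> + (\<beta> / 2 - \<alpha>) * (lam * r)) * x = \<beta> / 2 * x" for x by simp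
    from this[of "n3 p"] this[of "n2 p"]
    have k: "- \<omega> * n3 p + lam * \<nu> * \<beta> / 2 * (- \<nu> * n3 p) - (\<beta> / 2 - \<alpha>) * n3 p * (lam * r) = - (\<beta> / 2 * n3 p)"
      "\<omega> * n2 p - lam * \<nu> * \<beta> / 2 * (- \<nu> * n2 p) + (\<beta> / 2 - \<alpha>) * n2 p * (lam * r) = \<beta> / 2 * n2 p"
      unfolding distrib_right by (simp_all add: ac_simps)
    show ?thesis
      unfolding P_N[OF TJT_flds(1) p T_frame[OF p]] D_TJT(5)[OF p] k JT_frame[OF p]
      by (simp add: algebra_simps)
  qed
  have J: "P JT N p = (lam * \<beta> / 2) *\<^sub>R T p - \<mu> p *\<^sub>R JT p"
  proof -
    have k: "\<beta> / 2 * (n3 p * n3 p - n2 p * - n2 p) = \<beta> / 2 * r"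
      unfolding n_norm[OF p, symmetric] by (simp add: algebra_simps)
    show ?thesis
      unfolding P_N[OF TJT_flds(2) p JT_frame[OF p]] D_TJT(6)[OF p] k
      unfolding T_frame[OF p] JT_frame[OF p]
      by (simp add: algebra_simps)
  qed
  show "shape_operator P N T p = (\<beta> / 2) *\<^sub>R JT p"
    "shape_operator P N JT p = - (lam * \<beta> / 2) *\<^sub>R T p + \<mu> p *\<^sub>R JT p"
    by (simp_all add: shape_operator_def T J)
qed

end

theorem proposition5p1:
  fixes \<kappa> \<tau> lam \<nu> :: real
    and S :: "'m topology" and Atl :: "'m chart set"
    and F N :: "'m \<Rightarrow> real^4"
    and DH :: "(real^4 \<Rightarrow> real^4) \<Rightarrow> (real^4 \<Rightarrow> real^4) \<Rightarrow> real^4 \<Rightarrow> real^4"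
    and P D :: "('m \<Rightarrow> real^4) \<Rightarrow> ('m \<Rightarrow> real^4) \<Rightarrow> 'm \<Rightarrow> real^4"
  assumes "\<kappa> > 0" and "\<tau> > 0"
    and "helix_surface \<kappa> \<tau> S Atl F lam N \<nu>" and "\<nu> \<noteq> 0"
    and "levi_civita (AdS_geometry \<kappa> \<tau>) DH"
    and "connection_along \<kappa> \<tau> S Atl F DH P"
    and "levi_civita (surface_geometry \<kappa> \<tau> S Atl F) D"
  shows "let G = surface_geometry \<kappa> \<tau> S Atl F;
             T = tangent_part \<kappa> \<tau> F lam N;
             JT = J_rot \<kappa> \<tau> F N T;
             A = shape_operator P N;
             B = \<nu>\<^sup>2 * (\<tau>\<^sup>2 - 1) - lam
         in T \<in> flds G \<and> JT \<in> flds G \<and>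
            (\<forall>p\<in>pts G. T p \<noteq> JT p \<and> independent {T p, JT p} \<and>
               span {T p, JT p} = surface_tangent Atl F p) \<and>
            (\<exists>\<mu>\<in>fns G.
               (\<forall>p\<in>pts G.
                  A T p = (sqrt \<kappa> / 2 * \<tau>) *\<^sub>R JT p \<and>
                  A JT p = - (sqrt \<kappa> / 2 * lam * \<tau>) *\<^sub>R T p + \<mu> p *\<^sub>R JT p) \<and>
               (\<forall>p\<in>pts G.
                  D T T p = (\<nu> * \<tau> * sqrt \<kappa>) *\<^sub>R JT p \<and>
                  D JT T p = (\<mu> p * \<nu>) *\<^sub>R JT p \<and>
                  D T JT p = (lam * \<nu> * \<tau> * sqrt \<kappa>) *\<^sub>R T p \<and>
                  D JT JT p = (lam * \<mu> p * \<nu>) *\<^sub>R T p) \<and>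
               has_gaussian_curvature G D (\<lambda>p. lam * \<kappa> * \<nu>\<^sup>2 * (1 - \<tau>\<^sup>2)) \<and>
               (\<forall>p\<in>pts G. dif G \<mu> p (T p) + \<nu> * (\<mu> p)\<^sup>2 + \<kappa> * \<nu> * B = 0))"
proof -
  interpret helix_shape \<kappa> \<tau> S Atl F D lam \<nu> N DH P
    using assms by unfold_locales (simp_all add: helix_surface_def)
  have \<beta>: "\<beta> / 2 = sqrt \<kappa> / 2 * \<tau>" "lam * \<beta> / 2 = sqrt \<kappa> / 2 * lam * \<tau>"
    "\<nu> * \<beta> = \<nu> * \<tau> * sqrt \<kappa>" "lam * \<nu> * \<beta> = lam * \<nu> * \<tau> * sqrt \<kappa>"
    by (simp_all add: \<beta>_def)
  show ?thesis
    unfolding Let_def geometry_simps(1-4)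
    using TJT_flds TJT_basis shape_TJT[unfolded \<beta>] D_TJT(1-4)[unfolded \<beta>] gaussian_curvature riccati
    by (intro conjI ballI bexI[of _ \<mu>]) (simp_all add: sm_mu del: geometry_simps)
qed

end
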